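(* Let $G$ be a locally compact abelian group and let $\sigma\in M(G)$ be an atomic measure. Then $\sigma\in(\mathcal{P}_0\cap\mathcal{D}_0)^+$ if and only if there exist (i) a nonnegative atomic even measure $\omega_{\rm at}\ge 0$, (ii) an atomic real measure $\rho_{\rm at}$ of positive type, (iii) an atomic real odd measure $o_{\rm at}$, all in $M(G)$, such that $\sigma=\omega_{\rm at}+\rho_{\rm at}+o_{\rm at}$.
   Context: $G$ is a locally compact abelian (Hausdorff) group, written additively, with Haar measure $\lambda$. $M(G)$ denotes the set of real regular Borel measures of finite total variation on $G$, identified with the dual of the real Banach space $(\mathcal{C}_0(G,\mathbb{R}),\|\cdot\|_\infty)$ of continuous real functions vanishing at infinity. A measure in $M(G)$ is atomic if it is of the form $\sum_j a_j\delta_{x_j}$ with countably many points $x_j\in G$, $\sum_j|a_j|<\infty$, and $\delta_x$ the Dirac measure at $x$. A measure $\mu$ is even (odd) if $\mu(-E)=\mu(E)$ (respectively $\mu(-E)=-\mu(E)$) for all Borel $E$. A function $f:G\to\mathbb{C}$ is positive definite if $\sum_{j,k=1}^n c_j\overline{c_k}f(x_j-x_k)\ge 0$ for all $n\in\mathbb{N}$, $c_j\in\mathbb{C}$, $x_j\in G$. $\mathcal{P}_0$ is the set of nonnegative functions in $\mathcal{C}_0(G,\mathbb{R})$; $\mathcal{D}_0$ is the set of positive definite functions in $\mathcal{C}_0(G,\mathbb{R})$. For $S\subseteq\mathcal{C}_0(G,\mathbb{R})$, the dual cone is $S^+=\{\mu\in M(G): \int_G f\,d\mu\ge 0 \text{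 for all } f\in S\}$. For $u\in\mathcal{C}_c(G,\mathbb{C})$ (continuous, compact support) put $\widetilde{u}(x)=\overline{u(-x)}$ and $(u\star\widetilde{u})(x)=\int_G u(x-y)\widetilde{u}(y)\,d\lambda(y)$. A measure $\mu$ is of positive type if $\int_G(u\star\widetilde{u})\,d\mu\ge 0$ for all $u\in\mathcal{C}_c(G,\mathbb{C})$. *)

theory Defs
  imports "HOL-Probability.Probability"
begin

definition haar_measure :: "'a::topological_ab_group_add measure \<Rightarrow> bool" where
  "haar_measure H \<longleftrightarrow>
     sets H = sets borel \<and>
     (\<forall>K. compact K \<longrightarrow> emeasure H K < \<infinity>) \<and>
     (\<forall>E\<in>sets borel. emeasure H E = (INF U\<in>{U. open U \<and> E \<subseteq> U}. emeasure H U)) \<and>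
     (\<forall>U. open U \<longrightarrow> emeasure H U = (SUP K\<in>{K. compact K \<and> K \<subseteq> U}. emeasure H K)) \<and>
     emeasure H UNIV \<noteq> 0 \<and>
     (\<forall>x. \<forall>E\<in>sets borel. emeasure H ((+) x ` E) = emeasure H E)"

text \<open>A real measure is a real-valued set function. Only its values on Borel sets matter; it is
  required to vanish on all other sets, so that equality of real measures is equality of functions.\<close>

definition total_variation :: "('a::topological_space set \<Rightarrow> real) \<Rightarrow> 'a set \<Rightarrow> ennreal" where
  "total_variation \<mu> E =
     (SUP A\<in>{A :: nat \<Rightarrow> 'a set. range A \<subseteq> sets borel \<and> disjoint_family A \<and> (\<Union>i. A i) = E}.
        \<Sum>i. ennreal \<bar>\<mu> (A i)\<bar>)"

definition real_measures :: "('a::topological_space set \<Rightarrow> real) set" where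
  "real_measures = {\<mu>.
     (\<forall>E. E \<notin> sets borel \<longrightarrow> \<mu> E = 0) \<and>
     (\<forall>A :: nat \<Rightarrow> 'a set. range A \<subseteq> sets borel \<longrightarrow> disjoint_family A \<longrightarrow>
        (\<lambda>i. \<mu> (A i)) sums \<mu> (\<Union>i. A i)) \<and>
     total_variation \<mu> UNIV < \<infinity> \<and>
     (\<forall>E\<in>sets borel.
        total_variation \<mu> E = (INF U\<in>{U. open U \<and> E \<subseteq> U}. total_variation \<mu> U) \<and>
        total_variation \<mu> E = (SUP K\<in>{K. compact K \<and> K \<subseteq> E}. total_variation \<mu> K))}"

text \<open>The Jordan decomposition: the positive and negative variations are
  \<open>(\<bar>\<mu>\<bar> + \<mu>) / 2\<close> and \<open>(\<bar>\<mu>\<bar> - \<mu>) / 2\<close>. They are meaningful for \<open>\<mu> \<in> real_measures\<close>, where both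
  set functions are nonnegative, finite and countably additive.\<close>

definition positive_variation :: "('a::topological_space set \<Rightarrow> real) \<Rightarrow> 'a measure" where
  "positive_variation \<mu> = measure_of UNIV (sets borel)
     (\<lambda>E. ennreal ((enn2real (total_variation \<mu> E) + \<mu> E) / 2))"

definition negative_variation :: "('a::topological_space set \<Rightarrow> real) \<Rightarrow> 'a measure" where
  "negative_variation \<mu> = measure_of UNIV (sets borel)
     (\<lambda>E. ennreal ((enn2real (total_variation \<mu> E) - \<mu> E) / 2))"

definition real_measure_integral ::
  "('a::topological_space set \<Rightarrow> real) \<Rightarrow> ('a \<Rightarrow> 'b::{banach,second_countable_topology}) \<Rightarrow> 'b" where
  "real_measure_integral \<mu> f =
     integral\<^sup>L (positive_variation \<mu>) f - integral\<^sup>L (negative_variation \<mu>) f"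

text \<open>Finite combinations of Dirac measures are covered by taking almost all \<open>a j\<close> to be zero.\<close>

definition atomic_measure :: "('a::topological_space set \<Rightarrow> real) \<Rightarrow> bool" where
  "atomic_measure \<mu> \<longleftrightarrow>
     (\<exists>(a :: nat \<Rightarrow> real) (x :: nat \<Rightarrow> 'a). summable (\<lambda>j. \<bar>a j\<bar>) \<and>
        (\<forall>E\<in>sets borel. \<mu> E = (\<Sum>j. a j * measure (return borel (x j)) E)))"

definition nonneg_measure :: "('a::topological_space set \<Rightarrow> real) \<Rightarrow> bool" where
  "nonneg_measure \<mu> \<longleftrightarrow> (\<forall>E\<in>sets borel. 0 \<le> \<mu> E)"

definition even_measure :: "('a::topological_ab_group_add set \<Rightarrow> real) \<Rightarrow> bool" where
  "even_measure \<mu> \<longleftrightarrow> (\<forall>E\<in>sets borel. \<mu> (uminus ` E) = \<mu> E)"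

definition odd_measure :: "('a::topological_ab_group_add set \<Rightarrow> real) \<Rightarrow> bool" where
  "odd_measure \<mu> \<longleftrightarrow> (\<forall>E\<in>sets borel. \<mu> (uminus ` E) = - \<mu> E)"

definition C0 :: "('a::topological_space \<Rightarrow> real) set" where
  "C0 = {f. continuous_on UNIV f \<and> (\<forall>\<epsilon>>0. \<exists>K. compact K \<and> (\<forall>x. x \<notin> K \<longrightarrow> \<bar>f x\<bar> < \<epsilon>))}"

definition Cc :: "('a::topological_space \<Rightarrow> complex) set" where
  "Cc = {u. continuous_on UNIV u \<and> compact (closure {x. u x \<noteq> 0})}"

text \<open>Membership in \<open>\<real>\<^sub>\<ge>\<^sub>0\<close> says that a complex number is real and nonnegative.\<close>

definition positive_definite :: "('a::ab_group_add \<Rightarrow> complex) \<Rightarrow> bool" where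
  "positive_definite f \<longleftrightarrow>
     (\<forall>(n::nat) (c :: nat \<Rightarrow> complex) (x :: nat \<Rightarrow> 'a).
        (\<Sum>j<n. \<Sum>k<n. c j * cnj (c k) * f (x j - x k)) \<in> \<real>\<^sub>\<ge>\<^sub>0)"

definition P0 :: "('a::topological_space \<Rightarrow> real) set" where
  "P0 = {f \<in> C0. \<forall>x. 0 \<le> f x}"

definition D0 :: "('a::topological_ab_group_add \<Rightarrow> real) set" where
  "D0 = {f \<in> C0. positive_definite (\<lambda>x. complex_of_real (f x))}"

definition dual_cone ::
  "('a::topological_space \<Rightarrow> real) set \<Rightarrow> ('a set \<Rightarrow> real) set" where
  "dual_cone S = {\<mu> \<in> real_measures. \<forall>f\<in>S. 0 \<le> real_measure_integral \<mu> f}"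

definition convolution_of ::
  "'a::topological_ab_group_add measure \<Rightarrow> ('a \<Rightarrow> complex) \<Rightarrow> ('a \<Rightarrow> complex) \<Rightarrow> 'a \<Rightarrow> complex" where
  "convolution_of H u v x = (\<integral>y. u (x - y) * v y \<partial>H)"

definition conj_reflection :: "('a::ab_group_add \<Rightarrow> complex) \<Rightarrow> 'a \<Rightarrow> complex" where
  "conj_reflection u x = cnj (u (- x))"

definition positive_type ::
  "'a::topological_ab_group_add measure \<Rightarrow> ('a set \<Rightarrow> real) \<Rightarrow> bool" where
  "positive_type H \<mu> \<longleftrightarrow>
     (\<forall>u\<in>Cc. real_measure_integral \<mu> (convolution_of H u (conj_reflection u)) \<in> \<real>\<^sub>\<ge>\<^sub>0)"

end

theory Submission
  imports Defs "HOL-Real_Asymp.Real_Asymp"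
begin

text \<open>An atomic measure is a summable function \<open>p\<close> on the discrete group underlying \<open>G\<close>, and all
  conditions are read off from \<open>p\<close>. Testing against autocorrelations of bump functions with small
  support shows that an atomic measure of positive type has a positive definite even part as a
  function on points. Conversely, for summable positive definite \<open>p\<close> and positive definite \<open>q\<close>,
  Schur's product theorem and averaging over Folner sets (which exist since finitely generated
  abelian groups have polynomial growth) give \<open>\<Sum> p q \<ge> 0\<close>. This yields sufficiency.

  For necessity let \<open>s\<close> be the even part of \<open>p\<close>. One looks for \<open>w \<ge> 0\<close> such that \<open>s - w\<close> is positive
  definite. On a finite set of points this is finite-dimensional conic duality; the dual certificates
  are nonnegative finite sums of autocorrelations, which smear out to test functions in
  \<open>\<P>\<^sub>0 \<inter> \<D>\<^sub>0\<close>. Positive definiteness bounds \<open>w\<close> pointwise by \<open>\<bar>s x\<bar> + \<bar>s 0\<bar>\<close>, so Tychonoff's theorem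
  passes to the whole group, and averaging over Folner sets again shows that \<open>w\<close> is summable.\<close>

section \<open>Positive semidefinite kernels on finite sets\<close>

text \<open>Integrals against an atomic measure see only point values, so the group can be treated
  as discrete; Folner averages stand in for Fourier analysis on its compact dual. Real positive
  definite functions are even, hence the tests see only the even part of \<open>p\<close>, and the
  odd summand absorbs the rest.

  The finite problem is not translation invariant: on a finite set the nonnegative part is
  \<open>w (x - y)\<close>, but the positive semidefinite part has to range over all kernels
  \<open>P\<close>. Only when the residual vanishes does \<open>P\<close> turn out to depend on
  \<open>x - y\<close> alone.

  Two compactness arguments need bounds, and both get them from the diagonal. There
  \<open>w 0\<close> and the diagonal entry of the kernel are nonnegative and cannot cancel, so
  \<open>s 0\<close> and the residual bound them both; the diagonal of a positive semidefinite
  kernel then controls all its entries. The product topology does not see summability, which is why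
  it is recovered afterwards.\<close>

definition psd_on :: "'b set \<Rightarrow> ('b \<Rightarrow> 'b \<Rightarrow> real) \<Rightarrow> bool" where
  "psd_on E K \<longleftrightarrow> (\<forall>x\<in>E. \<forall>y\<in>E. K x y = K y x) \<and>
     (\<forall>c. 0 \<le> (\<Sum>x\<in>E. \<Sum>y\<in>E. c x * c y * K x y))"

lemma psd_on_sym: "psd_on E K \<Longrightarrow> x \<in> E \<Longrightarrow> y \<in> E \<Longrightarrow> K x y = K y x"
  by (auto simp: psd_on_def)

lemma psd_onD: "psd_on E K \<Longrightarrow> 0 \<le> (\<Sum>x\<in>E. \<Sum>y\<in>E. c x * c y * K x y)"
  by (auto simp: psd_on_def)

lemma psd_on_subset:
  assumes "finite E" "psd_on E K" "F \<subseteq> E"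
  shows "psd_on F K"
  unfolding psd_on_def
proof (intro conjI ballI allI)
  fix c :: "'a \<Rightarrow> real"
  define d where "d x = (if x \<in> F then c x else 0)" for x
  have "(\<Sum>x\<in>E. \<Sum>y\<in>E. d x * d y * K x y) = (\<Sum>x\<in>F. \<Sum>y\<in>E. d x * d y * K x y)"
    by (rule sum.mono_neutral_right) (use assms in \<open>auto simp: d_def\<close>)
  also have "\<dots> = (\<Sum>x\<in>F. \<Sum>y\<in>F. d x * d y * K x y)"
    by (intro sum.cong refl sum.mono_neutral_right) (use assms in \<open>auto simp: d_def\<close>)
  also have "\<dots> = (\<Sum>x\<in>F. \<Sum>y\<in>F. c x * c y * K x y)"
    by (intro sum.cong refl) (auto simp: d_def)
  finally show "0 \<le> (\<Sum>x\<in>F. \<Sum>y\<in>F. c x * c y * K x y)"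
    using psd_onD[OF assms(2), of d] by simp
qed (use assms in \<open>auto simp: psd_on_def\<close>)

lemma psd_on_pair:
  assumes "finite E" "psd_on E K" "x \<in> E" "y \<in> E" "x \<noteq> y"
  shows "0 \<le> a * a * K x x + 2 * a * b * K x y + b * b * K y y"
proof -
  have "psd_on {x, y} K"
    using psd_on_subset[OF assms(1,2), of "{x,y}"] assms by auto
  from psd_onD[OF this, of "\<lambda>z. if z = x then a else b"] psd_on_sym[OF assms(2-4)] assms(5)
  show ?thesis by (simp add: algebra_simps)
qed

lemma psd_on_diag:
  assumes "finite E" "psd_on E K" "x \<in> E"
  shows "0 \<le> K x x"
proof -
  have "psd_on {x} K" using psd_on_subset[OF assms(1,2), of "{x}"] assms by auto
  from psd_onD[OF this, of "\<lambda>_. 1"] show ?thesis by simp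
qed

text \<open>The test vectors (1, 1) and (1, -1) give the arithmetic-mean form of Cauchy-Schwarz. It
  is the source of the later bounds by the diagonal.\<close>

lemma psd_on_abs_le:
  assumes "finite E" "psd_on E K" "x \<in> E" "y \<in> E"
  shows "2 * \<bar>K x y\<bar> \<le> K x x + K y y"
proof (cases "x = y")
  case True
  then show ?thesis using psd_on_diag[OF assms(1-3)] by simp
next
  case False
  show ?thesis
    using psd_on_pair[OF assms False, of 1 1] psd_on_pair[OF assms False, of 1 "-1"] by simp
qed

text \<open>With a zero diagonal entry the form on the pair is affine in \<open>a\<close>; being
  bounded below, it has slope zero.\<close>

lemma psd_on_zero_diag:
  assumes "finite E" "psd_on E K" "x \<in> E" "y \<in> E" "K x x = 0"
  shows "K x y = 0"
proof (cases "x = y")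
  case False
  have *: "0 \<le> 2 * a * K x y + K y y" for a
    using psd_on_pair[OF assms(1-4) False, of a 1] assms(5) by simp
  show ?thesis
  proof (rule ccontr)
    assume ne: "K x y \<noteq> 0"
    have "2 * (- (K y y + 1) / (2 * K x y)) * K x y + K y y = -1"
      using ne by (simp add: field_simps)
    with *[of "- (K y y + 1) / (2 * K x y)"] show False by linarith
  qed
qed (use assms in auto)

text \<open>Replaces the spectral decomposition in the proof of Schur's product theorem.\<close>

lemma psd_on_schur_complement:
  assumes "finite E" "psd_on E K" "e \<in> E" "K e e > 0"
  shows "psd_on E (\<lambda>x y. K x y - K e x * K e y / K e e)"
  unfolding psd_on_def
proof (intro conjI ballI allI)
  fix x y assume "x \<in> E" "y \<in> E"
  then show "K x y - K e x * K e y / K e e = K y x - K e y * K e x / K e e"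
    using psd_on_sym[OF assms(2)] by auto
next
  fix c :: "'a \<Rightarrow> real"
  define S where "S = (\<Sum>x\<in>E. c x * K e x)"
  \<comment> \<open>\<open>c\<close> is corrected in the coordinate \<open>e\<close> so that
    \<open>d\<close> becomes orthogonal to the row \<open>K e\<close>. The form of \<open>K\<close>
    at \<open>d\<close> is then the form of the complement at \<open>c\<close>.\<close>
  define d where "d x = c x - (if x = e then S / K e e else 0)" for x
  have d: "(\<Sum>x\<in>E. d x * f x) = (\<Sum>x\<in>E. c x * f x) - S / K e e * f e" for f
  proof -
    have "(\<Sum>x\<in>E. (if x = e then S / K e e else 0) * f x)
        = (\<Sum>x\<in>E. if x = e then S / K e e * f e else 0)"
      by (rule sum.cong) auto
    then show ?thesis
      using assms by (simp add: d_def left_diff_distrib sum_subtractf)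
  qed
  have S': "(\<Sum>x\<in>E. c x * K x e) = S"
    unfolding S_def using psd_on_sym[OF assms(2)] assms(3) by (auto intro!: sum.cong)
  have "(\<Sum>x\<in>E. \<Sum>y\<in>E. d x * d y * K x y) = (\<Sum>x\<in>E. d x * (\<Sum>y\<in>E. d y * K x y))"
    by (simp add: sum_distrib_left mult.assoc)
  also have "\<dots> = (\<Sum>x\<in>E. c x * (\<Sum>y\<in>E. d y * K x y)) - S / K e e * (\<Sum>y\<in>E. d y * K e y)"
    by (rule d)
  also have "(\<Sum>y\<in>E. d y * K e y) = 0"
    using assms(4) unfolding d S_def by simp
  also have "(\<Sum>x\<in>E. c x * (\<Sum>y\<in>E. d y * K x y))
      = (\<Sum>x\<in>E. c x * (\<Sum>y\<in>E. c y * K x y)) - S / K e e * S"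
  proof -
    have "(\<Sum>x\<in>E. c x * (S / K e e * K x e)) = S / K e e * (\<Sum>x\<in>E. c x * K x e)"
      by (simp add: sum_distrib_left mult_ac)
    then show ?thesis
      unfolding d S' by (simp add: right_diff_distrib sum_subtractf)
  qed
  finally have "(\<Sum>x\<in>E. \<Sum>y\<in>E. d x * d y * K x y) = 
      (\<Sum>x\<in>E. c x * (\<Sum>y\<in>E. c y * K x y)) - S * S / K e e" by simp
  moreover have "(\<Sum>x\<in>E. \<Sum>y\<in>E. c x * c y * (K x y - K e x * K e y / K e e)) =
      (\<Sum>x\<in>E. c x * (\<Sum>y\<in>E. c y * K x y)) - S * S / K e e"
  proof -
    have "(\<Sum>x\<in>E. \<Sum>y\<in>E. c x * c y * (K x y - K e x * K e y / K e e)) =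
        (\<Sum>x\<in>E. \<Sum>y\<in>E. c x * (c y * K x y) - (c x * K e x) * (c y * K e y) / K e e)"
      by (intro sum.cong refl) (simp add: algebra_simps)
    then show ?thesis
      unfolding S_def sum_product
      by (simp only: sum_subtractf sum_divide_distrib sum_distrib_left)
  qed
  ultimately show "0 \<le> (\<Sum>x\<in>E. \<Sum>y\<in>E. c x * c y * (K x y - K e x * K e y / K e e))"
    using psd_onD[OF assms(2), of d] by simp
qed

lemma sum_insert_zero_row:
  assumes "finite E" "e \<notin> E" "\<And>x. x \<in> insert e E \<Longrightarrow> f e x = 0" "\<And>x. x \<in> E \<Longrightarrow> f x e = 0"
  shows "(\<Sum>x\<in>insert e E. \<Sum>y\<in>insert e E. f x y) = (\<Sum>x\<in>E. \<Sum>y\<in>E. f x y :: real)"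
  using assms by simp

text \<open>Schur's theorem tested on the all-ones vector. Subtracting
  \<open>K e x * K e y / K e e\<close> clears row and column \<open>e\<close>, so the induction
  hypothesis covers the remainder, while the rank-one part contributes the form of \<open>Q\<close>
  at the vector \<open>K e\<close>. If \<open>K e e = 0\<close>, row and column are already
  zero.\<close>

lemma psd_on_inner_nonneg:
  assumes "finite E" "psd_on E K" "psd_on E Q"
  shows "0 \<le> (\<Sum>x\<in>E. \<Sum>y\<in>E. K x y * Q x y)"
  using assms
proof (induction E arbitrary: K rule: finite_induct)
  case (insert e E)
  have fin: "finite (insert e E)" using insert by simp
  note K = insert.prems(1) and Q = insert.prems(2)
  have QE: "psd_on E Q" by (rule psd_on_subset[OF fin Q]) auto
  show ?case
  proof (cases "K e e = 0")
    case True
    have 0: "K e x = 0" "K x e = 0" if "x \<in> insert e E" for x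
      using psd_on_zero_diag[OF fin K _ that True] psd_on_sym[OF K that, of e] by auto
    have "(\<Sum>x\<in>insert e E. \<Sum>y\<in>insert e E. K x y * Q x y) = (\<Sum>x\<in>E. \<Sum>y\<in>E. K x y * Q x y)"
      by (rule sum_insert_zero_row) (use insert 0 in auto)
    moreover have "psd_on E K" by (rule psd_on_subset[OF fin K]) auto
    ultimately show ?thesis using insert.IH QE by simp
  next
    case False
    then have pos: "K e e > 0" using psd_on_diag[OF fin K, of e] by simp
    define K' where "K' x y = K x y - K e x * K e y / K e e" for x y
    have K': "psd_on (insert e E) K'"
      unfolding K'_def by (rule psd_on_schur_complement[OF fin K]) (use pos in auto)
    have 0: "K' e x = 0" "K' x e = 0" if "x \<in> insert e E" for x
    proof -
      show "K' e x = 0" using pos by (simp add: K'_def)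
      then show "K' x e = 0" using psd_on_sym[OF K' that, of e] by simp
    qed
    have "(\<Sum>x\<in>insert e E. \<Sum>y\<in>insert e E. K x y * Q x y)
       = (\<Sum>x\<in>insert e E. \<Sum>y\<in>insert e E. K' x y * Q x y + K e x * K e y * Q x y / K e e)"
      by (intro sum.cong refl) (use pos in \<open>simp add: K'_def field_simps\<close>)
    also have "\<dots> = (\<Sum>x\<in>insert e E. \<Sum>y\<in>insert e E. K' x y * Q x y)
        + (\<Sum>x\<in>insert e E. \<Sum>y\<in>insert e E. K e x * K e y * Q x y) / K e e"
      by (simp only: sum.distrib sum_divide_distrib)
    also have "(\<Sum>x\<in>insert e E. \<Sum>y\<in>insert e E. K' x y * Q x y) = (\<Sum>x\<in>E. \<Sum>y\<in>E. K' x y * Q x y)"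
      by (rule sum_insert_zero_row) (use insert 0 in auto)
    finally have eq: "(\<Sum>x\<in>insert e E. \<Sum>y\<in>insert e E. K x y * Q x y) =
        (\<Sum>x\<in>E. \<Sum>y\<in>E. K' x y * Q x y)
        + (\<Sum>x\<in>insert e E. \<Sum>y\<in>insert e E. K e x * K e y * Q x y) / K e e" .
    have "psd_on E K'" by (rule psd_on_subset[OF fin K']) auto
    then have "0 \<le> (\<Sum>x\<in>E. \<Sum>y\<in>E. K' x y * Q x y)" using insert.IH QE by simp
    moreover have "0 \<le> (\<Sum>x\<in>insert e E. \<Sum>y\<in>insert e E. K e x * K e y * Q x y) / K e e"
      using psd_onD[OF Q, of "K e"] pos by (simp only: divide_nonneg_pos)
    ultimately show ?thesis unfolding eq by simp
  qed
qed simp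

text \<open>Real coefficients and distinct points, in contrast to \<open>positive_definite\<close>.
  The symmetry clause of \<open>psd_on\<close> makes up for the real coefficients, whose quadratic
  form cannot see the odd part of \<open>f\<close>.\<close>

definition pos_def :: "('a::ab_group_add \<Rightarrow> real) \<Rightarrow> bool" where
  "pos_def f \<longleftrightarrow> (\<forall>E. finite E \<longrightarrow> psd_on E (\<lambda>x y. f (x - y)))"

lemma pos_def_even: "pos_def f \<Longrightarrow> f (- x) = f x"
  using psd_on_sym[of "{x, 0}" "\<lambda>x y. f (x - y)" 0 x] by (auto simp: pos_def_def)

section \<open>Averaging over Folner sets\<close>

lemma folner_set:
  fixes S :: "'a::ab_group_add set" and \<epsilon> :: real
  assumes "finite S" "0 < \<epsilon>"
  obtains F where "finite F" "F \<noteq> {}"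
    "\<And>x. x \<in> S \<Longrightarrow> (1 - \<epsilon>) * card F \<le> card (F \<inter> (+) x ` F)"
proof -
  \<comment> \<open>\<open>g n\<close> is the combination of S with multiplicities
    \<open>n x\<close>, and \<open>B N\<close> collects those with multiplicities at most N. Adding
    an element of S raises one multiplicity by 1.\<close>
  define g where "g n = (\<Sum>x\<in>S. \<Sum>i<n x. x)" for n :: "'a \<Rightarrow> nat"
  define B where "B N = g ` (PiE S (\<lambda>_. {..N}))" for N
  have fin: "finite (B N)" for N
    unfolding B_def using assms(1) by (intro finite_imageI finite_PiE) auto
  have ne: "B N \<noteq> {}" for N
    unfolding B_def by (auto simp: PiE_eq_empty_iff)
  have card: "card (B N) \<le> (N + 1) ^ card S" for N
  proof -
    have "card (B N) \<le> card (PiE S (\<lambda>_. {..N}))"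
      unfolding B_def using assms(1) by (intro card_image_le finite_PiE) auto
    also have "\<dots> = (N + 1) ^ card S" using assms(1) by (simp add: card_PiE)
    finally show ?thesis .
  qed
  have sub: "B N \<subseteq> B (Suc N)" for N
    unfolding B_def by (intro image_mono PiE_mono) auto
  have shift: "(+) x ` B N \<subseteq> B (Suc N)" if "x \<in> S" for x N
  proof safe
    fix b assume "b \<in> B N"
    then obtain n where n: "n \<in> PiE S (\<lambda>_. {..N})" "b = g n" by (auto simp: B_def)
    have "g (n(x := Suc (n x))) = (\<Sum>y\<in>S. (\<Sum>i<n y. y) + (if y = x then x else 0))"
      unfolding g_def by (rule sum.cong) auto
    also have "\<dots> = x + g n" using that assms(1) by (simp add: g_def sum.distrib add.commute)
    finally have "x + b = g (n(x := Suc (n x)))" using n by simp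
    moreover have "n(x := Suc (n x)) \<in> PiE S (\<lambda>_. {..Suc N})"
      using n(1) that by (force simp: PiE_iff extensional_def)
    ultimately show "x + b \<in> B (Suc N)" unfolding B_def by blast
  qed
  \<comment> \<open>If every step enlarged the box by a factor above 1 + \<epsilon>, the
    cardinalities would grow exponentially, against the polynomial bound
    \<open>card\<close>.\<close>
  obtain N where N: "card (B (Suc N)) \<le> (1 + \<epsilon>) * card (B N)"
  proof (rule ccontr)
    assume "\<not> thesis"
    then have *: "card (B (Suc N)) > (1 + \<epsilon>) * card (B N)" for N
      using that[of N] not_le by blast
    have "(1 + \<epsilon>) ^ N \<le> card (B N)" for N
    proof (induction N)
      case 0
      show ?case using fin[of 0] ne[of 0] by (simp add: Suc_leI card_gt_0_iff)
    next
      case (Suc N)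
      have "(1 + \<epsilon>) ^ Suc N \<le> (1 + \<epsilon>) * card (B N)" using Suc assms(2) by simp
      then show ?case using *[of N] by linarith
    qed
    then have le: "(1 + \<epsilon>) ^ N \<le> (real N + 1) ^ card S" for N
      using card[of N] by (smt (verit) of_nat_1 of_nat_add of_nat_le_iff of_nat_power)
    define k where "k = card S"
    have "(\<lambda>N. (real N + 1) ^ k / (1 + \<epsilon>) ^ N) \<longlonglongrightarrow> 0"
      using assms(2) by real_asymp
    then have "eventually (\<lambda>N. (real N + 1) ^ k / (1 + \<epsilon>) ^ N < 1) sequentially"
      by (rule order_tendstoD) simp
    then obtain N where "(real N + 1) ^ k / (1 + \<epsilon>) ^ N < 1"
      by (meson eventually_sequentially order_refl)
    with le[of N] assms(2) show False
      by (simp add: k_def divide_less_eq)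
  qed
  show ?thesis
  proof (rule that[of "B N"])
    fix x assume x: "x \<in> S"
    have inj: "card ((+) x ` B N) = card (B N)"
      by (simp add: card_image)
    \<comment> \<open>The box and its translate both lie in \<open>B (Suc N)\<close>, which is
      barely larger than either; inclusion-exclusion forces a large overlap.\<close>
    have "card (B N \<union> (+) x ` B N) \<le> card (B (Suc N))"
      using sub shift[OF x] fin by (intro card_mono) auto
    moreover have "card (B N) + card ((+) x ` B N)
        = card (B N \<union> (+) x ` B N) + card (B N \<inter> (+) x ` B N)"
      using fin by (intro card_Un_Int) auto
    ultimately have "2 * card (B N) \<le> card (B (Suc N)) + card (B N \<inter> (+) x ` B N)"
      using inj by linarith
    then show "(1 - \<epsilon>) * card (B N) \<le> card (B N \<inter> (+) x ` B N)"
      using N by (simp add: algebra_simps)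
  qed (use fin ne in auto)
qed

text \<open>The difference d arises from the pairs (x, x - d), so its multiplicity is the number of
  points of F that also lie in d + F.\<close>

lemma sum_differences_eq:
  fixes F :: "'a::ab_group_add set" and h :: "'a \<Rightarrow> real"
  assumes "finite F"
  shows "(\<Sum>x\<in>F. \<Sum>y\<in>F. h (x - y)) =
    (\<Sum>d\<in>(\<lambda>(x, y). x - y) ` (F \<times> F). h d * card (F \<inter> (+) d ` F))"
proof -
  define D where "D = (\<lambda>(x, y). x - y) ` (F \<times> F)"
  have finD: "finite D" using assms by (simp add: D_def)
  have "(\<Sum>x\<in>F. \<Sum>y\<in>F. h (x - y)) = (\<Sum>x\<in>F. \<Sum>d\<in>{d\<in>D. x - d \<in> F}. h d)"
  proof (rule sum.cong[OF refl])
    fix x assume x: "x \<in> F"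
    show "(\<Sum>y\<in>F. h (x - y)) = (\<Sum>d\<in>{d\<in>D. x - d \<in> F}. h d)"
      by (rule sum.reindex_bij_witness[of _ "\<lambda>d. x - d" "\<lambda>y. x - y"])
         (use x in \<open>force simp: D_def\<close>)+
  qed
  also have "\<dots> = (\<Sum>x\<in>F. \<Sum>d\<in>D. if x - d \<in> F then h d else 0)"
    using finD by (intro sum.cong[OF refl] sum.inter_filter)
  also have "\<dots> = (\<Sum>d\<in>D. \<Sum>x\<in>F. if x - d \<in> F then h d else 0)"
    by (rule sum.swap)
  also have "\<dots> = (\<Sum>d\<in>D. h d * card (F \<inter> (+) d ` F))"
  proof (rule sum.cong[OF refl])
    fix d
    have "F \<inter> (+) d ` F = {x\<in>F. x - d \<in> F}" by (force simp: image_iff)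
    then show "(\<Sum>x\<in>F. if x - d \<in> F then h d else 0) = h d * card (F \<inter> (+) d ` F)"
      using assms by (simp add: sum.inter_filter[symmetric] mult.commute)
  qed
  finally show ?thesis unfolding D_def .
qed

section \<open>Unordered sums of real functions, and their approximation by averages\<close>

lemma summable_on_tail:
  fixes f :: "'b \<Rightarrow> real"
  assumes "f summable_on UNIV" "0 < \<epsilon>"
  obtains S where "finite S" "(\<Sum>\<^sub>\<infinity>x\<in>-S. \<bar>f x\<bar>) \<le> \<epsilon>"
proof -
  have s: "(\<lambda>x. \<bar>f x\<bar>) summable_on UNIV"
    using assms(1) summable_on_iff_abs_summable_on_real[of f UNIV] by simp
  obtain S where S: "finite S" "dist (sum (\<lambda>x. \<bar>f x\<bar>) S) (\<Sum>\<^sub>\<infinity>x. \<bar>f x\<bar>) \<le> \<epsilon>"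
    using infsum_finite_approximation[OF s assms(2)] by auto
  have "(\<Sum>\<^sub>\<infinity>x\<in>-S. \<bar>f x\<bar>) = (\<Sum>\<^sub>\<infinity>x. \<bar>f x\<bar>) - (\<Sum>x\<in>S. \<bar>f x\<bar>)"
    unfolding Compl_eq_Diff_UNIV using S(1) s
    by (subst infsum_Diff) (auto intro: summable_on_subset_banach)
  then show ?thesis using that S by (auto simp: dist_real_def)
qed

lemma summable_on_abs_le:
  fixes f g :: "'b \<Rightarrow> real"
  assumes "g summable_on A" "\<And>x. x \<in> A \<Longrightarrow> \<bar>f x\<bar> \<le> g x"
  shows "f summable_on A"
proof -
  have "Infinite_Sum.abs_summable_on g A"
    using assms(1) summable_on_iff_abs_summable_on_real[of g A] by simp
  then have "Infinite_Sum.abs_summable_on f A"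
    by (rule Infinite_Sum.abs_summable_on_comparison_test) (use assms(2) in force)
  then show ?thesis using summable_on_iff_abs_summable_on_real[of f A] by simp
qed

lemma summable_on_abs:
  fixes f :: "'b \<Rightarrow> real"
  shows "f summable_on A \<Longrightarrow> (\<lambda>x. \<bar>f x\<bar>) summable_on A"
  using summable_on_iff_abs_summable_on_real[of f A] by simp

lemma abs_infsum_le:
  fixes f g :: "'b \<Rightarrow> real"
  assumes "g summable_on A" "\<And>x. x \<in> A \<Longrightarrow> \<bar>f x\<bar> \<le> g x"
  shows "\<bar>infsum f A\<bar> \<le> infsum g A"
proof -
  have f: "f summable_on A" by (rule summable_on_abs_le[OF assms])
  have "\<bar>infsum f A\<bar> \<le> (\<Sum>\<^sub>\<infinity>x\<in>A. \<bar>f x\<bar>)"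
    using norm_infsum_bound[of f A] summable_on_abs[OF f] by simp
  also have "\<dots> \<le> infsum g A"
    by (rule infsum_mono[OF summable_on_abs[OF f] assms(1)]) (use assms in auto)
  finally show ?thesis .
qed

text \<open>After division by \<open>card F\<close>, each \<open>h d\<close> is weighted by the
  overlap ratio of F and d + F. This weight lies in [0, 1] and is nearly 1 on a finite set that
  carries almost all of the mass of h.\<close>

lemma average_differences_approx:
  fixes h :: "'a::ab_group_add \<Rightarrow> real"
  assumes h: "h summable_on UNIV" and "0 < \<epsilon>"
  obtains F where "finite F" "F \<noteq> {}"
    "\<bar>(\<Sum>x\<in>F. \<Sum>y\<in>F. h (x - y)) / card F - infsum h UNIV\<bar> \<le> \<epsilon>"
proof -
  define H where "H = (\<Sum>\<^sub>\<infinity>x. \<bar>h x\<bar>)"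
  have abs: "(\<lambda>x. \<bar>h x\<bar>) summable_on A" for A
    by (rule summable_on_subset_banach[OF summable_on_abs[OF h]]) auto
  have H0: "0 \<le> H" unfolding H_def by (rule infsum_nonneg) auto
  \<comment> \<open>\<delta> * H pays for the points of S, where the weight misses 1 by at most
    \<delta>; one more \<delta> pays for the tail.\<close>
  define \<delta> where "\<delta> = \<epsilon> / (H + 1)"
  have "\<delta> * (H + 1) = \<epsilon>" using H0 by (simp add: \<delta>_def)
  then have \<delta>: "0 < \<delta>" "\<delta> * H + \<delta> = \<epsilon>"
    using \<open>0 < \<epsilon>\<close> H0 by (auto simp: \<delta>_def distrib_left)
  obtain S where S: "finite S" "(\<Sum>\<^sub>\<infinity>x\<in>-S. \<bar>h x\<bar>) \<le> \<delta>"
    using summable_on_tail[OF h \<delta>(1)] by blast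
  obtain F where F: "finite F" "F \<noteq> {}"
    "\<And>x. x \<in> S \<Longrightarrow> (1 - \<delta>) * card F \<le> card (F \<inter> (+) x ` F)"
    using folner_set[OF S(1) \<delta>(1)] by blast
  define N where "N d = card (F \<inter> (+) d ` F) / card F" for d
  have cF: "card F > 0" using F by (simp add: card_gt_0_iff)
  have N: "0 \<le> N d" "N d \<le> 1" for d
    using F cF by (auto simp: N_def divide_le_eq intro!: card_mono)
  have NS: "1 - \<delta> \<le> N d" if "d \<in> S" for d
    using F(3)[OF that] cF by (simp add: N_def le_divide_eq)
  define D where "D = (\<lambda>(x, y). x - y) ` (F \<times> F)"
  have finD: "finite D" using F by (simp add: D_def)
  have ND: "N d = 0" if "d \<notin> D" for d
  proof -
    have "F \<inter> (+) d ` F = {}" using that by (force simp: D_def image_iff)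
    then show ?thesis by (simp add: N_def)
  qed
  have sN: "(\<lambda>d. h d * N d) summable_on UNIV"
    by (rule summable_on_abs_le[OF abs]) (use N in \<open>auto simp: abs_mult mult_left_le\<close>)
  have "(\<Sum>x\<in>F. \<Sum>y\<in>F. h (x - y)) / card F = (\<Sum>d\<in>D. h d * N d)"
    unfolding sum_differences_eq[OF F(1)] D_def N_def by (simp add: sum_divide_distrib)
  also have "\<dots> = (\<Sum>\<^sub>\<infinity>d\<in>D. h d * N d)" using finD by simp
  also have "\<dots> = (\<Sum>\<^sub>\<infinity>d. h d * N d)"
    by (rule infsum_cong_neutral) (auto simp: ND)
  finally have "(\<Sum>x\<in>F. \<Sum>y\<in>F. h (x - y)) / card F - infsum h UNIV
      = (\<Sum>\<^sub>\<infinity>d. h d * N d + - h d)"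
    using sN h by (subst infsum_add) (auto simp: infsum_uminus summable_on_uminus)
  moreover have "\<bar>\<Sum>\<^sub>\<infinity>d. h d * N d + - h d\<bar> \<le> (\<Sum>\<^sub>\<infinity>d. \<delta> * \<bar>h d\<bar> + (if d \<in> - S then \<bar>h d\<bar> else 0))"
  proof (rule abs_infsum_le)
    have "(\<lambda>d. if d \<in> - S then \<bar>h d\<bar> else 0) summable_on UNIV"
      by (rule summable_on_abs_le[OF abs]) auto
    then show "(\<lambda>d. \<delta> * \<bar>h d\<bar> + (if d \<in> - S then \<bar>h d\<bar> else 0)) summable_on UNIV"
      by (intro summable_on_add summable_on_cmult_right abs)
    fix d
    have "h d * N d + - h d = - (h d * (1 - N d))" by (simp add: right_diff_distrib)
    then have eq: "\<bar>h d * N d + - h d\<bar> = \<bar>h d\<bar> * (1 - N d)"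
      using N[of d] by (simp only: abs_minus_cancel abs_mult)
    show "\<bar>h d * N d + - h d\<bar> \<le> \<delta> * \<bar>h d\<bar> + (if d \<in> - S then \<bar>h d\<bar> else 0)"
    proof (cases "d \<in> S")
      case True
      then have "\<bar>h d\<bar> * (1 - N d) \<le> \<bar>h d\<bar> * \<delta>" using NS[of d] by (intro mult_left_mono) auto
      then show ?thesis using eq True by (simp add: mult.commute)
    next
      case False
      have "\<bar>h d\<bar> * (1 - N d) \<le> \<bar>h d\<bar>" using N[of d] by (simp add: mult_left_le)
      then show ?thesis using eq False \<delta> by (simp add: add_increasing)
    qed
  qed
  moreover have "(\<Sum>\<^sub>\<infinity>d. \<delta> * \<bar>h d\<bar> + (if d \<in> - S then \<bar>h d\<bar> else 0))
      = \<delta> * H + (\<Sum>\<^sub>\<infinity>d\<in>-S. \<bar>h d\<bar>)"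
  proof -
    have "(\<Sum>\<^sub>\<infinity>d. if d \<in> - S then \<bar>h d\<bar> else 0) = (\<Sum>\<^sub>\<infinity>d\<in>-S. \<bar>h d\<bar>)"
      by (rule infsum_cong_neutral) auto
    moreover have "(\<lambda>d. if d \<in> - S then \<bar>h d\<bar> else 0) summable_on UNIV"
      by (rule summable_on_abs_le[OF abs]) auto
    ultimately show ?thesis
      by (subst infsum_add) (auto simp: H_def infsum_cmult_right' intro: summable_on_cmult_right abs)
  qed
  ultimately have "\<bar>(\<Sum>x\<in>F. \<Sum>y\<in>F. h (x - y)) / card F - infsum h UNIV\<bar> \<le> \<epsilon>"
    using S(2) \<delta> by linarith
  with that F show ?thesis by blast
qed

lemma infsum_nonneg_if_differences_nonneg:
  fixes h :: "'a::ab_group_add \<Rightarrow> real"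
  assumes "h summable_on UNIV" "\<And>F. finite F \<Longrightarrow> 0 \<le> (\<Sum>x\<in>F. \<Sum>y\<in>F. h (x - y))"
  shows "0 \<le> infsum h UNIV"
proof (rule field_le_epsilon)
  fix \<epsilon> :: real assume "0 < \<epsilon>"
  from average_differences_approx[OF assms(1) this] obtain F where F: "finite F"
    "\<bar>(\<Sum>x\<in>F. \<Sum>y\<in>F. h (x - y)) / card F - infsum h UNIV\<bar> \<le> \<epsilon>" by blast
  have "0 \<le> (\<Sum>x\<in>F. \<Sum>y\<in>F. h (x - y)) / card F" using assms(2)[OF F(1)] by simp
  then show "0 \<le> infsum h UNIV + \<epsilon>" using F(2) by linarith
qed

lemma infsum_pos_def_mult_nonneg:
  fixes p q :: "'a::ab_group_add \<Rightarrow> real"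
  assumes "pos_def p" "pos_def q" "(\<lambda>x. p x * q x) summable_on UNIV"
  shows "0 \<le> (\<Sum>\<^sub>\<infinity>x. p x * q x)"
  using assms by (intro infsum_nonneg_if_differences_nonneg psd_on_inner_nonneg) (auto simp: pos_def_def)

text \<open>Testing s - w on the constant vector 1 over a Folner set F bounds the double sum of w by
  that of s. The latter is at most \<open>card F\<close> times the norm of s, the former at least
  \<open>card F / 2\<close> times a prescribed finite partial sum of w.\<close>

lemma summable_on_if_pos_def_diff:
  fixes s w :: "'a::ab_group_add \<Rightarrow> real"
  assumes s: "s summable_on UNIV" and w: "\<And>x. 0 \<le> w x" and pd: "pos_def (\<lambda>x. s x - w x)"
  shows "w summable_on UNIV"
proof (rule nonneg_bdd_above_summable_on)
  show "bdd_above (sum w ` {F. F \<subseteq> UNIV \<and> finite F})"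
  proof (rule bdd_aboveI2)
    fix S :: "'a set" assume "S \<in> {F. F \<subseteq> UNIV \<and> finite F}"
    then have S: "finite S" by simp
    \<comment> \<open>The ratio 1/2 makes each point of S a difference of F with multiplicity at
      least \<open>card F / 2\<close>, and causes the factor 2 in the final bound.\<close>
    obtain F where F: "finite F" "F \<noteq> {}"
      "\<And>x. x \<in> S \<Longrightarrow> (1 - 1/2) * card F \<le> card (F \<inter> (+) x ` F)"
      using folner_set[OF S, of "1/2"] by auto
    have cF: "card F > 0" using F by (simp add: card_gt_0_iff)
    define D where "D = (\<lambda>(x, y). x - y) ` (F \<times> F)"
    have finD: "finite D" using F by (simp add: D_def)
    have SD: "S \<subseteq> D"
    proof
      fix x assume "x \<in> S"
      then have "F \<inter> (+) x ` F \<noteq> {}" using F(3)[of x] cF by force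
      then show "x \<in> D" by (force simp: D_def image_iff)
    qed
    have "sum w S * (card F / 2) = (\<Sum>d\<in>S. w d * (card F / 2))"
      by (simp add: sum_distrib_right)
    also have "\<dots> \<le> (\<Sum>d\<in>S. w d * card (F \<inter> (+) d ` F))"
      using F(3) w by (intro sum_mono mult_left_mono) auto
    also have "\<dots> \<le> (\<Sum>d\<in>D. w d * card (F \<inter> (+) d ` F))"
      using SD finD w by (intro sum_mono2) auto
    also have "\<dots> = (\<Sum>x\<in>F. \<Sum>y\<in>F. w (x - y))"
      unfolding D_def by (rule sum_differences_eq[OF F(1), symmetric])
    also have "\<dots> \<le> (\<Sum>x\<in>F. \<Sum>y\<in>F. s (x - y))"
      using pd F(1) psd_onD[of F "\<lambda>x y. s (x - y) - w (x - y)" "\<lambda>_. 1"]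
      by (simp add: pos_def_def sum_subtractf)
    also have "\<dots> = (\<Sum>d\<in>D. s d * card (F \<inter> (+) d ` F))"
      unfolding D_def by (rule sum_differences_eq[OF F(1)])
    also have "\<dots> \<le> (\<Sum>d\<in>D. \<bar>s d\<bar> * card F)"
      using F(1) by (intro sum_mono mult_mono) (auto intro!: card_mono)
    also have "\<dots> = (\<Sum>d\<in>D. \<bar>s d\<bar>) * card F" by (simp add: sum_distrib_right)
    also have "\<dots> \<le> (\<Sum>\<^sub>\<infinity>x. \<bar>s x\<bar>) * card F"
      using finite_sum_le_infsum[OF summable_on_abs[OF s], of D] finD by (intro mult_right_mono) auto
    finally show "sum w S \<le> 2 * (\<Sum>\<^sub>\<infinity>x. \<bar>s x\<bar>)" using cF by simp
  qed
qed (use w in auto)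

section \<open>Splitting off a nonnegative function\<close>

lemma compact_box:
  fixes X :: "'i \<Rightarrow> real set"
  assumes "\<And>i. compact (X i)"
  shows "compact {f. \<forall>i. f i \<in> X i}"
proof -
  have "compactin (product_topology (\<lambda>i. euclidean) UNIV) (PiE UNIV X)"
    using assms by (auto simp: compactin_PiE)
  moreover have "PiE UNIV X = {f. \<forall>i. f i \<in> X i}" by (auto simp: PiE_def)
  ultimately show ?thesis by (simp add: euclidean_product_topology)
qed

lemma continuous_on_coordinate:
  fixes f :: "'c::topological_space \<Rightarrow> 'i \<Rightarrow> real"
  assumes "continuous_on S f"
  shows "continuous_on S (\<lambda>z. f z i)"
  by (rule continuous_on_compose2[OF continuous_on_product_coordinates assms]) auto

lemmas continuous_on_coordinates =
  continuous_on_coordinate[OF continuous_on_id]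
  continuous_on_coordinate[OF continuous_on_fst[OF continuous_on_id]]
  continuous_on_coordinate[OF continuous_on_snd[OF continuous_on_id]]

lemma closed_psd_on:
  fixes K :: "'c::topological_space \<Rightarrow> 'b \<Rightarrow> 'b \<Rightarrow> real"
  assumes "\<And>x y. continuous_on UNIV (\<lambda>z. K z x y)"
  shows "closed {z. psd_on E (K z)}"
proof -
  have "{z. psd_on E (K z)} = (\<Inter>x\<in>E. \<Inter>y\<in>E. {z. K z x y = K z y x}) \<inter>
      (\<Inter>c. {z. 0 \<le> (\<Sum>x\<in>E. \<Sum>y\<in>E. c x * c y * K z x y)})"
    by (auto simp: psd_on_def)
  also have "closed \<dots>"
    by (intro closed_Int closed_INT ballI closed_Collect_eq closed_Collect_le
        continuous_on_sum continuous_on_mult continuous_on_const assms)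
  finally show ?thesis .
qed

lemma psd_on_add:
  assumes "psd_on E K" "psd_on E L"
  shows "psd_on E (\<lambda>x y. K x y + L x y)"
  unfolding psd_on_def
proof (intro conjI ballI allI)
  fix c :: "'a \<Rightarrow> real"
  show "0 \<le> (\<Sum>x\<in>E. \<Sum>y\<in>E. c x * c y * (K x y + L x y))"
    using psd_onD[OF assms(1), of c] psd_onD[OF assms(2), of c]
    by (simp add: distrib_left sum.distrib)
next
  fix x y assume "x \<in> E" "y \<in> E"
  then show "K x y + L x y = K y x + L y x"
    by (intro arg_cong2[of _ _ _ _ "(+)"] psd_on_sym[OF assms(1)] psd_on_sym[OF assms(2)])
qed

lemma psd_on_scale:
  assumes "psd_on E K" "0 \<le> t"
  shows "psd_on E (\<lambda>x y. t * K x y)"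
proof -
  have "(\<Sum>x\<in>E. \<Sum>y\<in>E. c x * c y * (t * K x y)) = t * (\<Sum>x\<in>E. \<Sum>y\<in>E. c x * c y * K x y)" for c
    by (simp add: sum_distrib_left mult_ac)
  moreover have "t * K x y = t * K y x" if "x \<in> E" "y \<in> E" for x y
    using psd_on_sym[OF assms(1) that] by (rule arg_cong)
  ultimately show ?thesis
    unfolding psd_on_def using psd_onD[OF assms(1)] assms(2) by simp
qed

lemma psd_on_rank_one: "psd_on E (\<lambda>x y. c x * c y)"
proof -
  have "(\<Sum>x\<in>E. \<Sum>y\<in>E. d x * d y * (c x * c y)) = (\<Sum>x\<in>E. d x * c x) ^ 2" for d
    by (simp add: power2_eq_square sum_product mult_ac)
  then show ?thesis
    unfolding psd_on_def by (simp add: mult.commute)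
qed

text \<open>First-order optimality: divide by t and let t tend to 0. The range of t stops at 1
  because one perturbation used below is a contraction by 1 - t.\<close>

lemma nonneg_if_quadratic_nonneg:
  fixes a b :: real
  assumes "0 \<le> b" "\<And>t. 0 < t \<Longrightarrow> t \<le> 1 \<Longrightarrow> 0 \<le> 2 * t * a + t * t * b"
  shows "0 \<le> a"
proof (rule ccontr)
  assume "\<not> 0 \<le> a"
  then have a: "a < 0" by simp
  \<comment> \<open>This t keeps \<open>t * b\<close> at most \<open>- a\<close>, so
    \<open>2 * a + t * b\<close> is at most \<open>a\<close> and hence negative. The 1 in the
    denominator covers b = 0.\<close>
  define t where "t = min 1 (- a / (b + 1))"
  have t: "0 < t" "t \<le> 1" using a assms(1) by (auto simp: t_def divide_neg_pos)
  have "t * b \<le> - a / (b + 1) * b" using assms(1) by (intro mult_right_mono) (auto simp: t_def)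
  also have "\<dots> = - a * (b / (b + 1))" by simp
  also have "\<dots> \<le> - a" using a assms(1) by (intro mult_left_le) auto
  finally have "t * (2 * a + t * b) < 0" using a t by (intro mult_pos_neg) auto
  then show False using assms(2)[OF t] by (simp add: algebra_simps)
qed

text \<open>The cone is unbounded, so the minimiser comes from coercivity. A competitor no worse
  than the zero pair has residual entries at most R. On the diagonal w 0 and P x x are nonnegative,
  hence P x x is at most |s 0| + R; the diagonal bounds P, and the residual then bounds w.\<close>

lemma psd_on_projection:
  fixes s :: "'a::ab_group_add \<Rightarrow> real"
  assumes E: "finite E" and even: "\<And>x. s (- x) = s x"
  obtains w P where "\<And>x. 0 \<le> w x" "\<And>x. w (- x) = w x" "psd_on E P"
    "\<forall>w' P'. (\<forall>x. 0 \<le> w' x) \<longrightarrow> (\<forall>x. w' (- x) = w' x) \<longrightarrow> psd_on E P' \<longrightarrow>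
      (\<Sum>x\<in>E. \<Sum>y\<in>E. (w (x - y) + P x y - s (x - y))\<^sup>2) \<le>
      (\<Sum>x\<in>E. \<Sum>y\<in>E. (w' (x - y) + P' x y - s (x - y))\<^sup>2)"
proof -
  define D where "D = (\<lambda>(x, y). x - y) ` (E \<times> E)"
  have finD: "finite D" using E by (simp add: D_def)
  have D: "x - y \<in> D" if "x \<in> E" "y \<in> E" for x y using that by (force simp: D_def)
  have Dm: "- d \<in> D" if "d \<in> D" for d
    using that by (force simp: D_def)
  have Dm': "- d \<in> D \<longleftrightarrow> d \<in> D" for d using Dm[of d] Dm[of "- d"] by auto
  define \<Phi> where "\<Phi> w P = (\<Sum>x\<in>E. \<Sum>y\<in>E. (w (x - y) + P (x, y) - s (x - y))\<^sup>2)" for w P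
  define R where "R = sqrt (\<Phi> (\<lambda>_. 0) (\<lambda>_. 0))"
  have \<Phi>0: "0 \<le> \<Phi> w P" for w P unfolding \<Phi>_def by (intro sum_nonneg) auto
  have R: "0 \<le> R" "R * R = \<Phi> (\<lambda>_. 0) (\<lambda>_. 0)" using \<Phi>0 by (auto simp: R_def)
  \<comment> \<open>Bounds \<open>w d\<close> by adding up |s d|, the residual R, and the bound |s
    0| + R for the kernel entry.\<close>
  define B where "B = (\<Sum>d\<in>D. \<bar>s d\<bar>) + \<bar>s 0\<bar> + 2 * R"
  have sD: "\<bar>s d\<bar> \<le> (\<Sum>d\<in>D. \<bar>s d\<bar>)" if "d \<in> D" for d
    using that finD by (intro member_le_sum) auto
  have sD0: "0 \<le> (\<Sum>d\<in>D. \<bar>s d\<bar>)" by (intro sum_nonneg) auto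
  have B: "0 \<le> B" using sD0 R by (simp add: B_def)
  \<comment> \<open>Values off the differences of E, and off pairs from E, do not enter the
    objective. Pinning them to 0 leaves compact boxes cut by closed conditions.\<close>
  define W where "W = {w. \<forall>x. w x \<in> (if x \<in> D then {0..B} else {0})} \<inter> {w. \<forall>x. w (- x) = w x}"
  define Q where "Q = {P. \<forall>z. P z \<in> (if z \<in> E \<times> E then {-B..B} else {0})} \<inter> {P. psd_on E (curry P)}"
  have zero: "(\<lambda>_. 0) \<in> W" "(\<lambda>_. 0) \<in> Q"
    using B by (auto simp: W_def Q_def psd_on_def curry_def)
  have "compact W"
    unfolding W_def
    by (intro compact_Int_closed compact_box closed_Collect_all closed_Collect_eq
        continuous_on_coordinates) auto
  moreover have "compact Q"
    unfolding Q_def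
    by (intro compact_Int_closed compact_box closed_psd_on)
       (auto simp: curry_def intro!: continuous_on_coordinates)
  ultimately have "compact (W \<times> Q)" by (rule compact_Times)
  moreover have "W \<times> Q \<noteq> {}"
    using zero by auto
  moreover have "continuous_on (W \<times> Q) (\<lambda>z. \<Phi> (fst z) (snd z))"
    unfolding \<Phi>_def
    by (intro continuous_on_sum continuous_on_power continuous_on_add continuous_on_diff
        continuous_on_const continuous_on_coordinates)
  ultimately have "\<exists>z\<in>W \<times> Q. \<forall>z'\<in>W \<times> Q. \<Phi> (fst z) (snd z) \<le> \<Phi> (fst z') (snd z')"
    by (rule continuous_attains_inf)
  then obtain w P where wP: "w \<in> W" "P \<in> Q"
    and min: "\<And>w' P'. w' \<in> W \<Longrightarrow> P' \<in> Q \<Longrightarrow> \<Phi> w P \<le> \<Phi> w' P'"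
    by fastforce
  have glob: "\<Phi> w P \<le> \<Phi> w' (case_prod P')"
    if w': "\<And>x. 0 \<le> w' x" "\<And>x. w' (- x) = w' x" and P': "psd_on E P'" for w' P'
  proof (cases "\<Phi> w' (case_prod P') \<le> R * R")
    case False
    then show ?thesis using min[OF zero] R by linarith
  next
    case True
    have ent: "\<bar>w' (x - y) + P' x y - s (x - y)\<bar> \<le> R" if "x \<in> E" "y \<in> E" for x y
    proof -
      have "(w' (x - y) + P' x y - s (x - y))\<^sup>2 \<le> (\<Sum>y\<in>E. (w' (x - y) + P' x y - s (x - y))\<^sup>2)"
        using that E by (intro member_le_sum[of y E "\<lambda>y. (w' (x - y) + P' x y - s (x - y))\<^sup>2"]) auto
      also have "\<dots> \<le> \<Phi> w' (case_prod P')"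
        using that E member_le_sum[of x E "\<lambda>x. \<Sum>y\<in>E. (w' (x - y) + P' x y - s (x - y))\<^sup>2"]
        by (simp add: \<Phi>_def sum_nonneg)
      finally have "(w' (x - y) + P' x y - s (x - y))\<^sup>2 \<le> R\<^sup>2" using True by (simp add: power2_eq_square)
      then show ?thesis using R(1) by (simp add: abs_le_square_iff[symmetric])
    qed
    have diag: "P' x x \<le> \<bar>s 0\<bar> + R" if "x \<in> E" for x
      using ent[OF that that] w'(1)[of 0] by simp
    have P'B: "\<bar>P' x y\<bar> \<le> \<bar>s 0\<bar> + R" if "x \<in> E" "y \<in> E" for x y
      using psd_on_abs_le[OF E P' that] diag[OF that(1)] diag[OF that(2)] by linarith
    have w'B: "w' d \<le> B" if d: "d \<in> D" for d
    proof -
      obtain x y where xy: "x \<in> E" "y \<in> E" "d = x - y" using d by (auto simp: D_def)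
      show ?thesis
        using ent[OF xy(1,2)] P'B[OF xy(1,2)] sD[OF d] by (simp add: xy(3) B_def)
    qed
    define w2 where "w2 x = (if x \<in> D then w' x else 0)" for x
    define P2 where "P2 z = (if z \<in> E \<times> E then P' (fst z) (snd z) else 0)" for z
    have "w2 \<in> W" using w' w'B Dm' by (auto simp: W_def w2_def)
    moreover have "P2 \<in> Q"
    proof -
      have "psd_on E (curry P2) = psd_on E P'"
        unfolding psd_on_def by (intro conj_cong ball_cong all_cong arg_cong2[of _ _ _ _ "(\<le>)"] sum.cong refl)
          (auto simp: P2_def curry_def)
      moreover have "- B \<le> P' x y \<and> P' x y \<le> B" if "x \<in> E" "y \<in> E" for x y
        using P'B[OF that] sD0 R(1) unfolding B_def by linarith
      ultimately show ?thesis using P' by (auto simp: Q_def P2_def)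
    qed
    ultimately have "\<Phi> w P \<le> \<Phi> w2 P2" by (rule min)
    also have "\<Phi> w2 P2 = \<Phi> w' (case_prod P')"
      unfolding \<Phi>_def by (intro sum.cong refl) (auto simp: w2_def P2_def D)
    finally show ?thesis .
  qed
  show ?thesis
  proof (rule that[of w "curry P"])
    show "0 \<le> w x" for x
    proof -
      have "w x \<in> (if x \<in> D then {0..B} else {0})" using wP(1) by (simp add: W_def)
      then show ?thesis by (simp split: if_splits)
    qed
    show "w (- x) = w x" for x using wP(1) by (simp add: W_def)
    show "psd_on E (curry P)" using wP(2) by (simp add: Q_def)
    show "\<forall>w' P'. (\<forall>x. 0 \<le> w' x) \<longrightarrow> (\<forall>x. w' (- x) = w' x) \<longrightarrow> psd_on E P' \<longrightarrow>
      (\<Sum>x\<in>E. \<Sum>y\<in>E. (w (x - y) + curry P x y - s (x - y))\<^sup>2) \<le>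
      (\<Sum>x\<in>E. \<Sum>y\<in>E. (w' (x - y) + P' x y - s (x - y))\<^sup>2)"
      using glob by (simp add: \<Phi>_def)
  qed
qed

text \<open>Finite-dimensional duality: the residual \<open>M\<close> of the projection of \<open>s\<close> onto the cone of kernels
  \<open>w (x - y) + P x y\<close> satisfies the Karush--Kuhn--Tucker conditions, so \<open>M\<close> is an admissible test
  kernel, and testing \<open>s\<close> against it forces \<open>M = 0\<close>.\<close>

lemma finite_nonneg_plus_psd:
  fixes s :: "'a::ab_group_add \<Rightarrow> real"
  assumes E: "finite E" and even: "\<And>x. s (- x) = s x"
    and test: "\<And>M. psd_on E M \<Longrightarrow> (\<And>d. 0 \<le> (\<Sum>x\<in>E. \<Sum>y\<in>E. if x - y = d then M x y else 0)) \<Longrightarrow>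
      0 \<le> (\<Sum>x\<in>E. \<Sum>y\<in>E. M x y * s (x - y))"
  obtains w where "\<And>x. 0 \<le> w x" "\<And>x. w (- x) = w x" "psd_on E (\<lambda>x y. s (x - y) - w (x - y))"
proof -
  obtain w P where w: "\<And>x. 0 \<le> w x" "\<And>x. w (- x) = w x" and P: "psd_on E P"
    and min: "\<forall>w' P'. (\<forall>x. 0 \<le> w' x) \<longrightarrow> (\<forall>x. w' (- x) = w' x) \<longrightarrow> psd_on E P' \<longrightarrow>
      (\<Sum>x\<in>E. \<Sum>y\<in>E. (w (x - y) + P x y - s (x - y))\<^sup>2) \<le>
      (\<Sum>x\<in>E. \<Sum>y\<in>E. (w' (x - y) + P' x y - s (x - y))\<^sup>2)"
    using psd_on_projection[where s = s, OF E even] by blast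
  \<comment> \<open>Approximation minus target: since the distance cannot decrease along a cone
    direction, this sign makes M pair nonnegatively with the cone.\<close>
  define M where "M x y = w (x - y) + P x y - s (x - y)" for x y
  have flip: "f (x - y) = f (y - x)" if "\<And>x. f (- x) = f x" for f :: "'a \<Rightarrow> real" and x y
    using that[of "y - x"] by simp
  have Msym: "M x y = M y x" if "x \<in> E" "y \<in> E" for x y
    using psd_on_sym[OF P that] flip[where f = w, OF w(2), of x y] flip[where f = s, OF even, of x y] by (simp add: M_def)
  have quad: "0 \<le> 2 * t * (\<Sum>x\<in>E. \<Sum>y\<in>E. M x y * N x y) + t * t * (\<Sum>x\<in>E. \<Sum>y\<in>E. (N x y)\<^sup>2)"
    if "\<And>x. 0 \<le> w' x" "\<And>x. w' (- x) = w' x" "psd_on E P'"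
      "\<And>x y. w' (x - y) + P' x y - s (x - y) = M x y + t * N x y" for w' P' N t
  proof -
    have "(\<Sum>x\<in>E. \<Sum>y\<in>E. (M x y)\<^sup>2)
        \<le> (\<Sum>x\<in>E. \<Sum>y\<in>E. (w' (x - y) + P' x y - s (x - y))\<^sup>2)"
      using min that(1-3) unfolding M_def by blast
    also have "\<dots> = (\<Sum>x\<in>E. \<Sum>y\<in>E. (M x y + t * N x y)\<^sup>2)"
      by (simp only: that(4))
    also have "\<dots> = (\<Sum>x\<in>E. \<Sum>y\<in>E. (M x y)\<^sup>2 + 2 * t * (M x y * N x y) + t * t * (N x y)\<^sup>2)"
      by (intro sum.cong refl) (simp add: power2_eq_square algebra_simps)
    finally show ?thesis by (simp add: sum.distrib sum_distrib_left)
  qed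
  have inner: "0 \<le> (\<Sum>x\<in>E. \<Sum>y\<in>E. M x y * (w' (x - y) + P' x y))"
    if w': "\<And>x. 0 \<le> w' x" "\<And>x. w' (- x) = w' x" and P': "psd_on E P'" for w' P'
  proof (rule nonneg_if_quadratic_nonneg)
    show "0 \<le> (\<Sum>x\<in>E. \<Sum>y\<in>E. (w' (x - y) + P' x y)\<^sup>2)" by (intro sum_nonneg) auto
    fix t :: real assume t: "0 < t"
    show "0 \<le> 2 * t * (\<Sum>x\<in>E. \<Sum>y\<in>E. M x y * (w' (x - y) + P' x y))
        + t * t * (\<Sum>x\<in>E. \<Sum>y\<in>E. (w' (x - y) + P' x y)\<^sup>2)"
      by (rule quad[of "\<lambda>x. w x + t * w' x" "\<lambda>x y. P x y + t * P' x y"])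
         (use t w w' in \<open>auto simp: M_def distrib_left intro!: psd_on_add P psd_on_scale P'\<close>)
  qed
  \<comment> \<open>Shrinking the optimal pair by 1 - t stays in the cone. This gives the opposite
    inequality for the pairing of M with the optimal pair itself.\<close>
  have compl: "0 \<le> (\<Sum>x\<in>E. \<Sum>y\<in>E. M x y * - (w (x - y) + P x y))"
  proof (rule nonneg_if_quadratic_nonneg)
    show "0 \<le> (\<Sum>x\<in>E. \<Sum>y\<in>E. (- (w (x - y) + P x y))\<^sup>2)" by (intro sum_nonneg) auto
    fix t :: real assume t: "0 < t" "t \<le> 1"
    show "0 \<le> 2 * t * (\<Sum>x\<in>E. \<Sum>y\<in>E. M x y * - (w (x - y) + P x y))
        + t * t * (\<Sum>x\<in>E. \<Sum>y\<in>E. (- (w (x - y) + P x y))\<^sup>2)"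
    proof (rule quad[of "\<lambda>x. (1 - t) * w x" "\<lambda>x y. (1 - t) * P x y"])
      show "psd_on E (\<lambda>x y. (1 - t) * P x y)" using t by (intro psd_on_scale P) simp
      show "0 \<le> (1 - t) * w x" "(1 - t) * w (- x) = (1 - t) * w x" for x
        using t w by auto
      show "(1 - t) * w (x - y) + (1 - t) * P x y - s (x - y) = M x y + t * - (w (x - y) + P x y)" for x y
        by (simp add: M_def algebra_simps)
    qed
  qed
  have "psd_on E M"
    unfolding psd_on_def
  proof (intro conjI ballI allI)
    fix c :: "'a \<Rightarrow> real"
    show "0 \<le> (\<Sum>x\<in>E. \<Sum>y\<in>E. c x * c y * M x y)"
      using inner[of "\<lambda>_. 0" "\<lambda>x y. c x * c y"] psd_on_rank_one[of E c] by (simp add: mult_ac)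
  qed (rule Msym)
  moreover have "0 \<le> (\<Sum>x\<in>E. \<Sum>y\<in>E. if x - y = d then M x y else 0)" for d
  proof -
    \<comment> \<open>Admissible directions are even, so d is tested together with - d; the symmetry
      of M makes both sums equal.\<close>
    define w' where "w' x = (if x = d then 1 else 0) + (if x = - d then 1 else (0::real))" for x
    have "0 \<le> (\<Sum>x\<in>E. \<Sum>y\<in>E. M x y * (w' (x - y) + 0))"
      by (rule inner) (auto simp: w'_def psd_on_def minus_equation_iff)
    also have "\<dots> = (\<Sum>x\<in>E. \<Sum>y\<in>E. (if x - y = d then M x y else 0) + (if x - y = - d then M x y else 0))"
      by (intro sum.cong refl) (auto simp: w'_def)
    also have "\<dots> = (\<Sum>x\<in>E. \<Sum>y\<in>E. if x - y = d then M x y else 0)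
        + (\<Sum>x\<in>E. \<Sum>y\<in>E. if x - y = - d then M x y else 0)"
      by (simp add: sum.distrib)
    also have "(\<Sum>x\<in>E. \<Sum>y\<in>E. if x - y = - d then M x y else 0)
        = (\<Sum>x\<in>E. \<Sum>y\<in>E. if y - x = - d then M y x else 0)" by (rule sum.swap)
    also have "\<dots> = (\<Sum>x\<in>E. \<Sum>y\<in>E. if x - y = d then M x y else 0)"
      by (intro sum.cong refl if_cong) (auto simp: Msym algebra_simps)
    finally show ?thesis by simp
  qed
  ultimately have "0 \<le> (\<Sum>x\<in>E. \<Sum>y\<in>E. M x y * s (x - y))" by (rule test)
  \<comment> \<open>The squared norm of M is its pairing with the approximation, at most 0 by
    \<open>compl\<close>, minus its pairing with s, at least 0 by \<open>test\<close>.\<close>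
  moreover have "(\<Sum>x\<in>E. \<Sum>y\<in>E. (M x y)\<^sup>2)
      = (\<Sum>x\<in>E. \<Sum>y\<in>E. - (M x y * - (w (x - y) + P x y)) - M x y * s (x - y))"
    by (intro sum.cong refl) (simp add: M_def power2_eq_square algebra_simps)
  ultimately have le: "(\<Sum>x\<in>E. \<Sum>y\<in>E. (M x y)\<^sup>2) \<le> 0"
    using compl by (simp only: sum_subtractf sum_negf)
  have "M x y = 0" if "x \<in> E" "y \<in> E" for x y
  proof -
    have "(\<Sum>y\<in>E. (M x y)\<^sup>2) \<le> 0"
      using le that E member_le_sum[of x E "\<lambda>x. \<Sum>y\<in>E. (M x y)\<^sup>2"] by (auto simp: sum_nonneg)
    moreover have "(M x y)\<^sup>2 \<le> (\<Sum>y\<in>E. (M x y)\<^sup>2)"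
      using that E member_le_sum[of y E "\<lambda>y. (M x y)\<^sup>2"] by auto
    ultimately show ?thesis by (smt (verit) power2_less_0 power2_eq_square zero_eq_power2)
  qed
  \<comment> \<open>With zero residual the kernel P, so far arbitrary, becomes a function of x -
    y.\<close>
  then have eq: "s (x - y) - w (x - y) = P x y" if "x \<in> E" "y \<in> E" for x y
    using that by (force simp: M_def)
  have "psd_on E (\<lambda>x y. s (x - y) - w (x - y)) = psd_on E P"
    unfolding psd_on_def by (intro conj_cong ball_cong all_cong arg_cong2[of _ _ _ _ "(\<le>)"] sum.cong refl)
      (auto simp: eq)
  with P have "psd_on E (\<lambda>x y. s (x - y) - w (x - y))" by simp
  then show ?thesis by (rule that[of w, OF w])
qed

lemma nonneg_plus_pos_def:
  fixes s :: "'a::ab_group_add \<Rightarrow> real"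
  assumes even: "\<And>x. s (- x) = s x"
    and test: "\<And>E M. finite E \<Longrightarrow> psd_on E M \<Longrightarrow>
      (\<And>d. 0 \<le> (\<Sum>x\<in>E. \<Sum>y\<in>E. if x - y = d then M x y else 0)) \<Longrightarrow>
      0 \<le> (\<Sum>x\<in>E. \<Sum>y\<in>E. M x y * s (x - y))"
  obtains w where "\<And>x. 0 \<le> w x" "\<And>x. w (- x) = w x" "pos_def (\<lambda>x. s x - w x)"
proof -
  define C where "C = {w. \<forall>x. w x \<in> {0..\<bar>s x\<bar> + \<bar>s 0\<bar>}}"
  define T where "T E = {w. \<forall>x. w (- x) = w x} \<inter> {w. psd_on E (\<lambda>x y. s (x - y) - w (x - y))}" for E
  have "compact C" unfolding C_def by (intro compact_box) auto
  moreover have "closed (T E)" if "E \<in> {E. finite E}" for E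
    unfolding T_def
    by (intro closed_Int closed_Collect_all closed_Collect_eq closed_psd_on
        continuous_on_diff continuous_on_const continuous_on_coordinates)
  moreover have "C \<inter> (\<Inter>E\<in>I. T E) \<noteq> {}" if I: "finite I" "I \<subseteq> {E. finite E}" for I
  proof -
    define E where "E = insert 0 (\<Union>I)"
    have E: "finite E" "0 \<in> E" using I by (auto simp: E_def)
    obtain w where w: "\<And>x. 0 \<le> w x" "\<And>x. w (- x) = w x" "psd_on E (\<lambda>x y. s (x - y) - w (x - y))"
      using finite_nonneg_plus_psd[where s = s and E = E, OF E(1) even test[OF E(1)]] by blast
    \<comment> \<open>Off the differences of E nothing bounds w, so it is set to 0 there in order to
      lie in C.\<close>
    define w' where "w' d = (if \<exists>x\<in>E. \<exists>y\<in>E. d = x - y then w d else 0)" for d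
    have w'_diff: "w' (x - y) = w (x - y)" if "x \<in> E" "y \<in> E" for x y using that by (auto simp: w'_def)
    have "w' (- d) = w' d" for d
    proof -
      have "(\<exists>x\<in>E. \<exists>y\<in>E. - d = x - y) \<longleftrightarrow> (\<exists>x\<in>E. \<exists>y\<in>E. d = x - y)"
        by (metis minus_diff_eq minus_minus)
      then show ?thesis using w(2) by (simp add: w'_def)
    qed
    moreover have "psd_on E (\<lambda>x y. s (x - y) - w' (x - y)) = psd_on E (\<lambda>x y. s (x - y) - w (x - y))"
      unfolding psd_on_def by (intro conj_cong ball_cong all_cong arg_cong2[of _ _ _ _ "(\<le>)"] sum.cong refl)
        (auto simp: w'_diff)
    moreover have "w' d \<in> {0..\<bar>s d\<bar> + \<bar>s 0\<bar>}" for d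
    proof (cases "\<exists>x\<in>E. \<exists>y\<in>E. d = x - y")
      case True
      then obtain x y where xy: "x \<in> E" "y \<in> E" "d = x - y" by blast
      \<comment> \<open>Both diagonal entries equal s 0 - w 0, at most s 0. So w d exceeds s d by at
        most s 0, the bound built into C.\<close>
      have "2 * \<bar>s (x - y) - w (x - y)\<bar> \<le> (s (x - x) - w (x - x)) + (s (y - y) - w (y - y))"
        by (rule psd_on_abs_le[OF E(1) w(3) xy(1,2)])
      then show ?thesis using xy w(1)[of 0] w(1)[of d] w'_diff[OF xy(1,2)]
        abs_ge_minus_self[of "s d - w d"] abs_ge_self[of "s d"] abs_ge_self[of "s 0"]
        by simp
    qed (simp add: w'_def)
    ultimately have "w' \<in> C" "w' \<in> T E" using w(3) by (auto simp: C_def T_def)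
    moreover have "T E \<subseteq> T F" if "F \<in> I" for F
      unfolding T_def using psd_on_subset[OF E(1), of _ F] that by (auto simp: E_def)
    ultimately show ?thesis by blast
  qed
  ultimately have "C \<inter> (\<Inter>E\<in>{E. finite E}. T E) \<noteq> {}"
    by (rule compact_imp_fip_image)
  then obtain w where w: "w \<in> C" "\<And>E. finite E \<Longrightarrow> w \<in> T E" by blast
  show ?thesis
  proof (rule that[of w])
    show "0 \<le> w x" for x using w(1) by (simp add: C_def)
    show "w (- x) = w x" for x using w(2)[of "{}"] by (simp add: T_def)
    show "pos_def (\<lambda>x. s x - w x)" using w(2) by (simp add: T_def pos_def_def)
  qed
qed

section \<open>Atomic measures\<close>

text \<open>The value 0 off the Borel sets follows the convention of \<open>real_measures\<close>,
  so that identities of atomic measures are equalities of functions.\<close>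

definition point_masses :: "('a::topological_space \<Rightarrow> real) \<Rightarrow> 'a set \<Rightarrow> real" where
  "point_masses p E = (if E \<in> sets borel then infsum p E else 0)"

lemma point_masses_singleton [simp]:
  fixes p :: "'a::t1_space \<Rightarrow> real"
  shows "point_masses p {x} = p x"
  by (simp add: point_masses_def)

lemma infsum_UN_disjoint_sums:
  fixes q :: "'b \<Rightarrow> real" and A :: "nat \<Rightarrow> 'b set"
  assumes q: "q summable_on UNIV" and A: "disjoint_family A"
  shows "(\<lambda>i. infsum q (A i)) sums infsum q (\<Union>i. A i)"
proof -
  have inj: "inj_on snd (Sigma UNIV A)"
  proof (rule inj_onI, clarsimp)
    fix i j x assume "x \<in> A i" "x \<in> A j"
    then show "i = j" using A unfolding disjoint_family_on_def by blast
  qed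
  have img: "snd ` Sigma UNIV A = (\<Union>i. A i)" by force
  have "q summable_on (snd ` Sigma UNIV A)"
    by (rule summable_on_subset_banach[OF q]) auto
  then have sum: "(\<lambda>(i, x). q x) summable_on Sigma UNIV A"
    unfolding summable_on_reindex[OF inj] by (simp add: comp_def case_prod_unfold)
  have "infsum q (\<Union>i. A i) = infsum (\<lambda>(i, x). q x) (Sigma UNIV A)"
    unfolding img[symmetric] infsum_reindex[OF inj] by (simp add: comp_def case_prod_unfold)
  also have "\<dots> = infsum (\<lambda>i. infsum q (A i)) UNIV"
    by (rule infsum_Sigma'_banach[OF sum, symmetric])
  finally have "((\<lambda>i. infsum q (A i)) has_sum infsum q (\<Union>i. A i)) UNIV"
    using summable_on_Sigma_banach[OF sum] by (simp add: has_sum_infsum)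
  then show ?thesis by (rule has_sum_imp_sums)
qed

context
  fixes p :: "'a::t2_space \<Rightarrow> real"
  assumes p: "p summable_on UNIV"
begin

lemma summable_on_UNIV_imp: "p summable_on E"
  by (rule summable_on_subset_banach[OF p]) auto

lemma summable_on_UNIV_imp_abs: "(\<lambda>x. \<bar>p x\<bar>) summable_on E"
  by (rule summable_on_abs[OF summable_on_UNIV_imp])

text \<open>The lower bound comes from partitions into the points of a finite subset and one
  remaining cell; singletons are Borel because points are closed.\<close>

lemma total_variation_point_masses:
  assumes E: "E \<in> sets borel"
  shows "total_variation (point_masses p) E = ennreal (\<Sum>\<^sub>\<infinity>x\<in>E. \<bar>p x\<bar>)" (is "?T = _")
proof (rule antisym)
  show "?T \<le> ennreal (\<Sum>\<^sub>\<infinity>x\<in>E. \<bar>p x\<bar>)"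
    unfolding total_variation_def
  proof (rule SUP_least, clarify)
    fix A :: "nat \<Rightarrow> 'a set"
    assume A: "range A \<subseteq> sets borel" "disjoint_family A" "E = \<Union> (range A)"
    have "(\<Sum>i. ennreal \<bar>point_masses p (A i)\<bar>) \<le> (\<Sum>i. ennreal (\<Sum>\<^sub>\<infinity>x\<in>A i. \<bar>p x\<bar>))"
    proof (intro suminf_le ennreal_leI)
      fix i
      show "\<bar>point_masses p (A i)\<bar> \<le> (\<Sum>\<^sub>\<infinity>x\<in>A i. \<bar>p x\<bar>)"
        using A(1) abs_infsum_le[OF summable_on_UNIV_imp_abs, of "A i" p]
        by (auto simp: point_masses_def)
    qed auto
    also have "\<dots> = ennreal (\<Sum>\<^sub>\<infinity>x\<in>\<Union> (range A). \<bar>p x\<bar>)"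
      by (rule suminf_ennreal_eq)
        (auto intro!: infsum_nonneg infsum_UN_disjoint_sums summable_on_UNIV_imp_abs A(2))
    finally show "(\<Sum>i. ennreal \<bar>point_masses p (A i)\<bar>) \<le> ennreal (\<Sum>\<^sub>\<infinity>x\<in>\<Union> (range A). \<bar>p x\<bar>)" .
  qed
next
  have fin: "ennreal (\<Sum>x\<in>F. \<bar>p x\<bar>) \<le> ?T" if F: "finite F" "F \<subseteq> E" for F
  proof -
    obtain e where e: "bij_betw e {..<card F} F"
      using ex_bij_betw_nat_finite[OF F(1)] by (auto simp: atLeast0LessThan)
    \<comment> \<open>Singletons of F first, the remainder at index \<open>card F\<close>, then
      empty cells to fill the sequence.\<close>
    define A where "A i = (if i < card F then {e i} else if i = card F then E - F else {})" for i
    have eF: "e i \<in> F" if "i < card F" for i using e that by (auto simp: bij_betw_def)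
    have F': "F = e ` {..<card F}" using e by (auto simp: bij_betw_def)
    have "F \<in> sets borel" using F(1) by (intro borel_closed finite_imp_closed)
    then have "range A \<subseteq> sets borel" using E by (auto simp: A_def)
    moreover have "disjoint_family A"
      unfolding disjoint_family_on_def A_def
      using e eF by (auto simp: bij_betw_def inj_on_def)
    moreover have "(\<Union>i. A i) = E"
    proof safe
      fix x assume "x \<in> E"
      show "x \<in> (\<Union>i. A i)"
      proof (cases "x \<in> F")
        case True
        then obtain i where "i < card F" "x = e i" using F' by auto
        then have "x \<in> A i" by (simp add: A_def)
        then show ?thesis by blast
      next
        case False
        then have "x \<in> A (card F)" using \<open>x \<in> E\<close> by (simp add: A_def)
        then show ?thesis by blast
      qed
    qed (use eF F(2) in \<open>auto simp: A_def split: if_splits\<close>)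
    ultimately have "(\<Sum>i. ennreal \<bar>point_masses p (A i)\<bar>) \<le> ?T"
      unfolding total_variation_def by (intro SUP_upper) auto
    moreover have "(\<Sum>i<card F. ennreal \<bar>point_masses p (A i)\<bar>) \<le> (\<Sum>i. ennreal \<bar>point_masses p (A i)\<bar>)"
      by (rule sum_le_suminf) auto
    moreover have "(\<Sum>i<card F. ennreal \<bar>point_masses p (A i)\<bar>) = (\<Sum>i<card F. ennreal \<bar>p (e i)\<bar>)"
      by (rule sum.cong) (auto simp: A_def)
    moreover have "\<dots> = (\<Sum>x\<in>F. ennreal \<bar>p x\<bar>)"
      by (rule sum.reindex_bij_betw[OF e])
    ultimately show ?thesis by (simp add: sum_ennreal)
  qed
  show "ennreal (\<Sum>\<^sub>\<infinity>x\<in>E. \<bar>p x\<bar>) \<le> ?T"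
  proof (cases ?T)
    case (real t)
    have "(\<Sum>\<^sub>\<infinity>x\<in>E. \<bar>p x\<bar>) \<le> t"
      by (rule infsum_le_finite_sums[OF summable_on_UNIV_imp_abs]) (use fin real in auto)
    then show ?thesis using real by (simp add: ennreal_leI)
  qed simp
qed

lemma infsum_abs_le_add:
  assumes "A \<subseteq> B \<union> C"
  shows "(\<Sum>\<^sub>\<infinity>x\<in>A. \<bar>p x\<bar>) \<le> (\<Sum>\<^sub>\<infinity>x\<in>B. \<bar>p x\<bar>) + (\<Sum>\<^sub>\<infinity>x\<in>C. \<bar>p x\<bar>)"
proof -
  have "(\<Sum>\<^sub>\<infinity>x\<in>A. \<bar>p x\<bar>) \<le> (\<Sum>\<^sub>\<infinity>x\<in>B \<union> (C - B). \<bar>p x\<bar>)"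
    by (rule infsum_mono2) (use assms summable_on_UNIV_imp_abs in auto)
  also have "\<dots> = (\<Sum>\<^sub>\<infinity>x\<in>B. \<bar>p x\<bar>) + (\<Sum>\<^sub>\<infinity>x\<in>C - B. \<bar>p x\<bar>)"
    by (rule infsum_Un_disjoint) (use summable_on_UNIV_imp_abs in auto)
  also have "(\<Sum>\<^sub>\<infinity>x\<in>C - B. \<bar>p x\<bar>) \<le> (\<Sum>\<^sub>\<infinity>x\<in>C. \<bar>p x\<bar>)"
    by (rule infsum_mono2) (use summable_on_UNIV_imp_abs in auto)
  finally show ?thesis by simp
qed

text \<open>Up to \<epsilon> the variation sits on a finite set S. Regularity follows: S \<inter> E
  is compact and approximates E from inside, - (S - E) is open and does so from outside.\<close>

lemma point_masses_in_real_measures: "point_masses p \<in> real_measures"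
proof -
  let ?T = "total_variation (point_masses p)"
  have add: "(\<lambda>i. point_masses p (A i)) sums point_masses p (\<Union>i. A i)"
    if "range A \<subseteq> sets borel" "disjoint_family A" for A :: "nat \<Rightarrow> 'a set"
  proof -
    have "point_masses p (A i) = infsum p (A i)" for i using that by (auto simp: point_masses_def)
    moreover have "(\<Union>i. A i) \<in> sets borel" using that by auto
    ultimately show ?thesis
      using infsum_UN_disjoint_sums[OF p that(2)] by (simp add: point_masses_def)
  qed
  have mono: "?T A \<le> ?T B" if "A \<subseteq> B" "A \<in> sets borel" "B \<in> sets borel" for A B
    using that by (auto simp: total_variation_point_masses intro!: ennreal_leI infsum_mono2 summable_on_UNIV_imp_abs)
  have bound: "?T A \<le> ?T B + ennreal \<epsilon>"
    if "A \<subseteq> B \<union> - S" "(\<Sum>\<^sub>\<infinity>x\<in>-S. \<bar>p x\<bar>) \<le> \<epsilon>" "A \<in> sets borel" "B \<in> sets borel" for A B S \<epsilon>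
  proof -
    have "(\<Sum>\<^sub>\<infinity>x\<in>A. \<bar>p x\<bar>) \<le> (\<Sum>\<^sub>\<infinity>x\<in>B. \<bar>p x\<bar>) + \<epsilon>"
      using infsum_abs_le_add[OF that(1)] that(2) by linarith
    moreover have "0 \<le> (\<Sum>\<^sub>\<infinity>x\<in>-S. \<bar>p x\<bar>)" "0 \<le> (\<Sum>\<^sub>\<infinity>x\<in>B. \<bar>p x\<bar>)" by (simp_all add: infsum_nonneg)
    ultimately have "ennreal (\<Sum>\<^sub>\<infinity>x\<in>A. \<bar>p x\<bar>) \<le> ennreal (\<Sum>\<^sub>\<infinity>x\<in>B. \<bar>p x\<bar>) + ennreal \<epsilon>"
      using that(2) ennreal_leI[of "\<Sum>\<^sub>\<infinity>x\<in>A. \<bar>p x\<bar>" "(\<Sum>\<^sub>\<infinity>x\<in>B. \<bar>p x\<bar>) + \<epsilon>"] by simp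
    then show ?thesis using that by (simp add: total_variation_point_masses)
  qed
  have outer: "?T E = (INF U\<in>{U. open U \<and> E \<subseteq> U}. ?T U)" if E: "E \<in> sets borel" for E
  proof (rule antisym)
    show "?T E \<le> (INF U\<in>{U. open U \<and> E \<subseteq> U}. ?T U)"
      using E by (intro INF_greatest mono) auto
    show "(INF U\<in>{U. open U \<and> E \<subseteq> U}. ?T U) \<le> ?T E"
    proof (rule ennreal_le_epsilon)
      fix \<epsilon> :: real assume "0 < \<epsilon>"
      then obtain S where S: "finite S" "(\<Sum>\<^sub>\<infinity>x\<in>-S. \<bar>p x\<bar>) \<le> \<epsilon>"
        using summable_on_tail[OF p] by blast
      define U where "U = - (S - E)"
      have "open U"
        unfolding U_def using S(1) by (intro open_Compl finite_imp_closed finite_Diff)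
      moreover have "E \<subseteq> U" by (auto simp: U_def)
      ultimately have U: "open U" "E \<subseteq> U" by auto
      have "(INF U\<in>{U. open U \<and> E \<subseteq> U}. ?T U) \<le> ?T U" using U by (intro INF_lower) auto
      also have "\<dots> \<le> ?T E + ennreal \<epsilon>"
        by (rule bound[OF _ S(2)]) (use U E in \<open>auto simp: U_def\<close>)
      finally show "(INF U\<in>{U. open U \<and> E \<subseteq> U}. ?T U) \<le> ?T E + ennreal \<epsilon>" .
    qed
  qed
  have inner: "?T E = (SUP K\<in>{K. compact K \<and> K \<subseteq> E}. ?T K)" if E: "E \<in> sets borel" for E
  proof (rule antisym)
    show "(SUP K\<in>{K. compact K \<and> K \<subseteq> E}. ?T K) \<le> ?T E"
      using E by (intro SUP_least mono) (auto intro: borel_compact)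
    show "?T E \<le> (SUP K\<in>{K. compact K \<and> K \<subseteq> E}. ?T K)"
    proof (rule ennreal_le_epsilon)
      fix \<epsilon> :: real assume "0 < \<epsilon>"
      then obtain S where S: "finite S" "(\<Sum>\<^sub>\<infinity>x\<in>-S. \<bar>p x\<bar>) \<le> \<epsilon>"
        using summable_on_tail[OF p] by blast
      have "?T E \<le> ?T (S \<inter> E) + ennreal \<epsilon>"
        by (rule bound[OF _ S(2)]) (use E S(1) in \<open>auto intro: borel_closed finite_imp_closed\<close>)
      also have "?T (S \<inter> E) \<le> (SUP K\<in>{K. compact K \<and> K \<subseteq> E}. ?T K)"
        using S(1) by (intro SUP_upper) (auto intro: finite_imp_compact)
      finally show "?T E \<le> (SUP K\<in>{K. compact K \<and> K \<subseteq> E}. ?T K) + ennreal \<epsilon>"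
        by (simp add: add_right_mono)
    qed
  qed
  show ?thesis
    unfolding real_measures_def
  proof (intro CollectI conjI allI impI ballI)
    show "?T UNIV < \<infinity>" by (simp add: total_variation_point_masses)
    show "point_masses p E = 0" if "E \<notin> sets borel" for E using that by (simp add: point_masses_def)
  qed (fact add outer inner)+
qed

lemma atomic_point_masses: "atomic_measure (point_masses p)"
proof -
  define S where "S = {x. p x \<noteq> 0}"
  have cS: "countable S"
    using abs_summable_countable[of p UNIV] p summable_on_iff_abs_summable_on_real[of p UNIV]
    by (simp add: S_def)
  \<comment> \<open>The codes of the support points. All other indices get coefficient 0, which also
    covers a finite or empty support.\<close>
  define J where "J = to_nat_on S ` S"
  define x where "x = from_nat_into S"
  define a where "a j = (if j \<in> J then p (x j) else 0)" for j
  have bij: "bij_betw x J S"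
    unfolding bij_betw_def inj_on_def J_def x_def using cS by force
  have sum_eq: "(\<Sum>\<^sub>\<infinity>j\<in>{j\<in>J. x j \<in> E}. p (x j)) = infsum p E" for E
  proof -
    have "bij_betw x {j\<in>J. x j \<in> E} (S \<inter> E)"
      using bij by (auto simp: bij_betw_def inj_on_def)
    then have "(\<Sum>\<^sub>\<infinity>j\<in>{j\<in>J. x j \<in> E}. p (x j)) = infsum p (S \<inter> E)"
      by (rule infsum_reindex_bij_betw)
    also have "\<dots> = infsum p E"
      by (rule infsum_cong_neutral) (auto simp: S_def)
    finally show ?thesis .
  qed
  have "(\<lambda>j. p (x j)) summable_on J"
    unfolding summable_on_reindex_bij_betw[OF bij] by (rule summable_on_UNIV_imp)
  moreover have "(\<lambda>j. p (x j)) summable_on J \<longleftrightarrow> a summable_on UNIV"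
    by (rule summable_on_cong_neutral) (auto simp: a_def)
  ultimately have suma: "a summable_on UNIV" by simp
  have "summable (\<lambda>j. \<bar>a j\<bar>)"
    by (rule summable_on_imp_summable[OF summable_on_abs[OF suma]])
  moreover have "point_masses p E = (\<Sum>j. a j * measure (return borel (x j)) E)"
    if E: "E \<in> sets borel" for E
  proof -
    have "(\<lambda>j. a j * indicator E (x j)) summable_on UNIV"
      by (rule summable_on_abs_le[OF summable_on_abs[OF suma]]) (auto simp: indicator_def)
    then have "(\<Sum>j. a j * indicator E (x j)) = (\<Sum>\<^sub>\<infinity>j. a j * indicator E (x j))"
      by (rule sums_unique[OF has_sum_imp_sums[OF has_sum_infsum], symmetric])
    also have "\<dots> = (\<Sum>\<^sub>\<infinity>j\<in>{j\<in>J. x j \<in> E}. p (x j))"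
      by (rule infsum_cong_neutral) (auto simp: a_def indicator_def)
    finally show ?thesis using E by (simp add: sum_eq point_masses_def measure_return)
  qed
  ultimately show ?thesis
    unfolding atomic_measure_def by (intro exI[of _ a] exI[of _ x] conjI ballI)
qed

text \<open>Since (|p| + p) / 2 is the positive part of p, the Jordan components are counting
  measures weighted with the positive and negative parts, and integrals become unordered
  sums.\<close>

lemma real_measure_integral_point_masses:
  fixes f :: "'a \<Rightarrow> 'b::{banach,second_countable_topology}"
  assumes f: "f \<in> borel_measurable borel" and bdd: "\<And>x. norm (f x) \<le> B"
  shows "(\<lambda>x. p x *\<^sub>R f x) summable_on UNIV"
    and "real_measure_integral (point_masses p) f = (\<Sum>\<^sub>\<infinity>x. p x *\<^sub>R f x)"
proof -
  have abs_sum: "Infinite_Sum.abs_summable_on (\<lambda>x. q x *\<^sub>R f x) UNIV"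
    if "q summable_on UNIV" for q :: "'a \<Rightarrow> real"
  proof (rule summable_on_abs_le)
    show "(\<lambda>x. \<bar>q x\<bar> * B) summable_on UNIV"
      by (intro summable_on_cmult_left summable_on_abs that)
  qed (use bdd in \<open>simp add: mult_left_mono\<close>)
  show "(\<lambda>x. p x *\<^sub>R f x) summable_on UNIV"
    by (rule abs_summable_summable[OF abs_sum[OF p]])
  define W where "W q = distr (density (count_space UNIV) (\<lambda>x. ennreal (q x))) borel (\<lambda>x. x)" 
    for q :: "'a \<Rightarrow> real"
  have emeasure_W: "emeasure (W q) E = ennreal (infsum q E)"
    if q: "\<And>x. 0 \<le> q x" "q summable_on UNIV" and E: "E \<in> sets borel" for q E
  proof -
    have "emeasure (W q) E = (\<integral>\<^sup>+x. ennreal (q x) * indicator E x \<partial>count_space UNIV)"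
      using E by (simp add: W_def emeasure_distr emeasure_density)
    also have "\<dots> = (\<integral>\<^sup>+x. ennreal (q x) \<partial>count_space E)"
      by (simp add: nn_integral_count_space_indicator)
    finally have eq: "emeasure (W q) E = (\<integral>\<^sup>+x. ennreal (q x) \<partial>count_space E)" .
    have "Infinite_Sum.abs_summable_on q E"
      using summable_on_subset_banach[OF q(2), of E] summable_on_iff_abs_summable_on_real[of q E] by simp
    then have s: "Infinite_Set_Sum.abs_summable_on q E" by (rule iffD1[OF abs_summable_equivalent])
    then have "(\<integral>\<^sup>+x. ennreal (q x) \<partial>count_space E) = ennreal (infsetsum q E)"
      by (rule nn_integral_conv_infsetsum) (use q in auto)
    then show ?thesis by (simp add: eq infsetsum_infsum[OF s])
  qed
  have integral_W: "integral\<^sup>L (W q) f = (\<Sum>\<^sub>\<infinity>x. q x *\<^sub>R f x)"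
    if q: "\<And>x. 0 \<le> q x" "q summable_on UNIV" for q
  proof -
    have "integral\<^sup>L (W q) f = infsetsum (\<lambda>x. q x *\<^sub>R f x) UNIV"
      unfolding W_def infsetsum_def using f q
      by (subst integral_distr) (auto simp: integral_density)
    then show ?thesis
      using infsetsum_infsum[OF iffD1[OF abs_summable_equivalent abs_sum[OF q(2)]]] by simp
  qed
  \<comment> \<open>\<open>measure_of\<close> returns a given set function only if that is a
    measure; agreement with \<open>emeasure (W q)\<close> on Borel sets ensures this.\<close>
  have W: "measure_of UNIV (sets borel) g = W q"
    if q: "\<And>x. 0 \<le> q x" "q summable_on UNIV"
      and g: "\<And>E. E \<in> sets borel \<Longrightarrow> g E = ennreal (infsum q E)" for q and g :: "'a set \<Rightarrow> ennreal"
  proof -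
    have "measure_of UNIV (sets borel) g = measure_of UNIV (sets borel) (emeasure (W q))"
      using g emeasure_W[OF q] sets.sigma_sets_eq[of "borel :: 'a measure"]
      by (intro measure_of_eq) auto
    also have "\<dots> = W q" using measure_of_of_measure[of "W q"] by (simp add: W_def)
    finally show ?thesis .
  qed
  define q1 where "q1 x = max 0 (p x)" for x
  define q2 where "q2 x = max 0 (- p x)" for x
  have q: "0 \<le> q1 x" "0 \<le> q2 x" "p x = q1 x - q2 x" "\<bar>p x\<bar> = q1 x + q2 x" for x
    by (auto simp: q1_def q2_def)
  have qs: "q1 summable_on E" "q2 summable_on E" for E
    by (rule summable_on_abs_le[OF summable_on_UNIV_imp_abs]; auto simp: q1_def q2_def)+
  have sums: "infsum p E = infsum q1 E - infsum q2 E" "(\<Sum>\<^sub>\<infinity>x\<in>E. \<bar>p x\<bar>) = infsum q1 E + infsum q2 E" for E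
  proof -
    have "infsum p E = (\<Sum>\<^sub>\<infinity>x\<in>E. q1 x + - q2 x)" by (rule infsum_cong) (simp add: q)
    also have "\<dots> = infsum q1 E + - infsum q2 E"
      using qs by (subst infsum_add) (auto simp: infsum_uminus summable_on_uminus)
    finally show "infsum p E = infsum q1 E - infsum q2 E" by simp
    show "(\<Sum>\<^sub>\<infinity>x\<in>E. \<bar>p x\<bar>) = infsum q1 E + infsum q2 E"
      unfolding q(4) using qs by (rule infsum_add)
  qed
  have nn: "0 \<le> infsum q1 E" "0 \<le> infsum q2 E" for E by (auto intro!: infsum_nonneg q)
  have "positive_variation (point_masses p) = W q1"
    unfolding positive_variation_def
    by (rule W) (use q(1,2) qs nn in \<open>auto simp: total_variation_point_masses point_masses_def sums simp del: ennreal_plus\<close>)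
  moreover have "negative_variation (point_masses p) = W q2"
    unfolding negative_variation_def
    by (rule W) (use q(1,2) qs nn in \<open>auto simp: total_variation_point_masses point_masses_def sums simp del: ennreal_plus\<close>)
  ultimately have "real_measure_integral (point_masses p) f
      = (\<Sum>\<^sub>\<infinity>x. q1 x *\<^sub>R f x) - (\<Sum>\<^sub>\<infinity>x. q2 x *\<^sub>R f x)"
    unfolding real_measure_integral_def using integral_W q qs by simp
  also have "\<dots> = (\<Sum>\<^sub>\<infinity>x. q1 x *\<^sub>R f x + - (q2 x *\<^sub>R f x))"
    using abs_summable_summable[OF abs_sum] qs
    by (subst infsum_add) (auto simp: infsum_uminus summable_on_uminus)
  also have "\<dots> = (\<Sum>\<^sub>\<infinity>x. p x *\<^sub>R f x)" by (simp add: q(3) scaleR_left_diff_distrib)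
  finally show "real_measure_integral (point_masses p) f = (\<Sum>\<^sub>\<infinity>x. p x *\<^sub>R f x)" .
qed

end

lemma atomic_measureE:
  fixes \<mu> :: "'a::t2_space set \<Rightarrow> real"
  assumes "\<mu> \<in> real_measures" "atomic_measure \<mu>"
  obtains p where "p summable_on UNIV" "\<mu> = point_masses p"
proof -
  obtain a :: "nat \<Rightarrow> real" and x :: "nat \<Rightarrow> 'a" where a: "summable (\<lambda>j. \<bar>a j\<bar>)"
    and \<mu>: "\<And>E. E \<in> sets borel \<Longrightarrow> \<mu> E = (\<Sum>j. a j * measure (return borel (x j)) E)"
    using assms(2) unfolding atomic_measure_def by blast
  have suma: "a summable_on UNIV" using a by (intro norm_summable_imp_summable_on) auto
  \<comment> \<open>The points \<open>x j\<close> may repeat, so the mass at y gathers all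
    coefficients placed there.\<close>
  define p where "p y = infsum a {j. x j = y}" for y
  have *: "(\<lambda>(y, j). a j) summable_on Sigma E (\<lambda>y. {j. x j = y})"
    "infsum (\<lambda>(y, j). a j) (Sigma E (\<lambda>y. {j. x j = y})) = infsum a {j. x j \<in> E}" for E
  proof -
    have inj: "inj_on snd (Sigma E (\<lambda>y. {j. x j = y}))" by (auto simp: inj_on_def)
    have img: "snd ` Sigma E (\<lambda>y. {j. x j = y}) = {j. x j \<in> E}" by force
    have "a summable_on {j. x j \<in> E}" by (rule summable_on_subset_banach[OF suma]) auto
    then show "(\<lambda>(y, j). a j) summable_on Sigma E (\<lambda>y. {j. x j = y})"
      unfolding img[symmetric] summable_on_reindex[OF inj] by (simp add: comp_def case_prod_unfold)
    show "infsum (\<lambda>(y, j). a j) (Sigma E (\<lambda>y. {j. x j = y})) = infsum a {j. x j \<in> E}"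
      unfolding img[symmetric] infsum_reindex[OF inj] by (simp add: comp_def case_prod_unfold)
  qed
  have psum: "p summable_on UNIV" unfolding p_def by (rule summable_on_Sigma_banach[OF *(1)])
  have "\<mu> E = point_masses p E" for E
  proof (cases "E \<in> sets borel")
    case True
    have "(\<lambda>j. a j * indicator E (x j)) summable_on UNIV"
      by (rule summable_on_abs_le[OF summable_on_abs[OF suma]]) (auto simp: indicator_def)
    then have "(\<Sum>j. a j * indicator E (x j)) = (\<Sum>\<^sub>\<infinity>j. a j * indicator E (x j))"
      by (rule sums_unique[OF has_sum_imp_sums[OF has_sum_infsum], symmetric])
    also have "\<dots> = infsum a {j. x j \<in> E}"
      by (rule infsum_cong_neutral) (auto simp: indicator_def)
    also have "\<dots> = infsum p E"
      unfolding p_def infsum_Sigma'_banach[OF *(1)] *(2) ..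
    finally show ?thesis using True \<mu> by (simp add: point_masses_def measure_return)
  next
    case False
    then show ?thesis using assms(1) by (auto simp: point_masses_def real_measures_def)
  qed
  with psum that show ?thesis by blast
qed

section \<open>Correlations of compactly supported functions\<close>

text \<open>Some compact set takes the place of the closed support: sums, translates and
  correlations then only have to exhibit one.\<close>

definition Ccr :: "('a::topological_space \<Rightarrow> real) set" where
  "Ccr = {v. continuous_on UNIV v \<and> (\<exists>K. compact K \<and> (\<forall>x. x \<notin> K \<longrightarrow> v x = 0))}"

lemma CcrI: "continuous_on UNIV v \<Longrightarrow> compact K \<Longrightarrow> (\<And>x. x \<notin> K \<Longrightarrow> v x = 0) \<Longrightarrow> v \<in> Ccr"
  by (auto simp: Ccr_def)

lemma CcrE:
  assumes "v \<in> Ccr"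
  obtains K where "continuous_on UNIV v" "compact K" "\<And>x. x \<notin> K \<Longrightarrow> v x = 0"
  using assms by (auto simp: Ccr_def)

lemma Ccr_subset_C0: "Ccr \<subseteq> C0"
  by (force simp: Ccr_def C0_def)

lemma C0_bounded:
  assumes "f \<in> C0"
  obtains B where "\<And>x. \<bar>f x\<bar> \<le> B"
proof -
  have cont: "continuous_on UNIV f" and "\<exists>K. compact K \<and> (\<forall>x. x \<notin> K \<longrightarrow> \<bar>f x\<bar> < 1)"
    using assms by (auto simp: C0_def)
  then obtain K where K: "compact K" "\<And>x. x \<notin> K \<Longrightarrow> \<bar>f x\<bar> < 1" by blast
  have "compact (f ` K)"
    by (rule compact_continuous_image[OF continuous_on_subset[OF cont] K(1)]) auto
  then have "bounded (f ` K)" by (rule compact_imp_bounded)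
  then obtain B where "\<And>x. x \<in> K \<Longrightarrow> \<bar>f x\<bar> \<le> B" by (auto simp: bounded_iff)
  then have "\<bar>f x\<bar> \<le> max B 1" for x using K(2)[of x] by (cases "x \<in> K") force+
  then show ?thesis by (rule that)
qed

lemma Ccr_add:
  assumes "u \<in> Ccr" "v \<in> Ccr"
  shows "(\<lambda>x. u x + v x) \<in> Ccr"
proof -
  obtain K where K: "continuous_on UNIV u" "compact K" "\<And>x. x \<notin> K \<Longrightarrow> u x = 0"
    using assms(1) unfolding Ccr_def by blast
  obtain L where L: "continuous_on UNIV v" "compact L" "\<And>x. x \<notin> L \<Longrightarrow> v x = 0"
    using assms(2) unfolding Ccr_def by blast
  show ?thesis
    by (rule CcrI[of _ "K \<union> L"]) (use K L in \<open>auto intro!: continuous_intros\<close>)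
qed

lemma Ccr_mult: "u \<in> Ccr \<Longrightarrow> v \<in> Ccr \<Longrightarrow> (\<lambda>x. u x * v x) \<in> Ccr"
  by (elim CcrE, rule CcrI) (auto intro!: continuous_intros)

lemma Ccr_cmult: "v \<in> Ccr \<Longrightarrow> (\<lambda>x. c * v x) \<in> Ccr"
  by (elim CcrE, rule CcrI) (auto intro!: continuous_intros)

lemma Ccr_zero: "(\<lambda>x. 0) \<in> Ccr"
  by (rule CcrI[of _ "{}"]) auto

lemma Ccr_sum: "(\<And>i. i \<in> I \<Longrightarrow> v i \<in> Ccr) \<Longrightarrow> (\<lambda>x. \<Sum>i\<in>I. v i x) \<in> Ccr"
  by (induction I rule: infinite_finite_induct) (auto intro: Ccr_zero Ccr_add)

lemma Ccr_translate:
  fixes v :: "'a::topological_ab_group_add \<Rightarrow> real"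
  assumes "v \<in> Ccr"
  shows "(\<lambda>y. v (y - x)) \<in> Ccr"
proof -
  obtain K where K: "continuous_on UNIV v" "compact K" "\<And>x. x \<notin> K \<Longrightarrow> v x = 0"
    using assms unfolding Ccr_def by blast
  show ?thesis
  proof (rule CcrI)
    show "continuous_on UNIV (\<lambda>y. v (y - x))"
      by (rule continuous_on_compose2[OF K(1)]) (auto intro!: continuous_intros)
    show "compact ((\<lambda>y. y + x) ` K)"
      by (rule compact_continuous_image[OF _ K(2)]) (auto intro!: continuous_intros)
    fix y assume "y \<notin> (\<lambda>y. y + x) ` K"
    then have "y - x \<notin> K" by (metis diff_add_cancel imageI)
    then show "v (y - x) = 0" by (rule K(3))
  qed
qed

lemma Ccr_reflect:
  fixes v :: "'a::topological_ab_group_add \<Rightarrow> real"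
  assumes "v \<in> Ccr"
  shows "(\<lambda>y. v (- y)) \<in> Ccr"
proof -
  obtain K where K: "continuous_on UNIV v" "compact K" "\<And>x. x \<notin> K \<Longrightarrow> v x = 0"
    using assms unfolding Ccr_def by blast
  show ?thesis
  proof (rule CcrI)
    show "continuous_on UNIV (\<lambda>y. v (- y))"
      by (rule continuous_on_compose2[OF K(1)]) (auto intro!: continuous_intros)
    show "compact (uminus ` K)"
      by (rule compact_continuous_image[OF _ K(2)]) (auto intro!: continuous_intros)
    fix y assume "y \<notin> uminus ` K"
    then have "- y \<notin> K" by (metis imageI minus_minus)
    then show "v (- y) = 0" by (rule K(3))
  qed
qed

lemma has_sum_sum:
  fixes f :: "'i \<Rightarrow> 'b \<Rightarrow> real"
  assumes "\<And>i. i \<in> I \<Longrightarrow> (f i has_sum s i) A"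
  shows "((\<lambda>x. \<Sum>i\<in>I. f i x) has_sum (\<Sum>i\<in>I. s i)) A"
  using assms by (induction I rule: infinite_finite_induct) (auto intro: has_sum_add)

text \<open>If a and b are both the reflection of a real function u, this is the convolution of u
  with its conjugate reflection, in a form adapted to translations.\<close>

definition cross_corr :: "'a::topological_ab_group_add measure \<Rightarrow> ('a \<Rightarrow> real) \<Rightarrow> ('a \<Rightarrow> real) \<Rightarrow> 'a \<Rightarrow> real"
  where "cross_corr H a b x = (\<integral>y. a (y - x) * b y \<partial>H)"

section \<open>Haar integrals and cross-correlations\<close>

context
  fixes H :: "'a::{topological_ab_group_add, t2_space} measure"
  assumes haar: "haar_measure H"
begin

lemma haar_sets: "sets H = sets borel"
  using haar by (simp add: haar_measure_def)

lemma haar_space: "space H = UNIV"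
  using sets_eq_imp_space_eq[OF haar_sets] by simp

lemma haar_measurable: "f \<in> borel_measurable borel \<Longrightarrow> f \<in> borel_measurable H"
  using measurable_cong_sets[OF haar_sets refl] by blast

lemma Ccr_integrable:
  assumes "v \<in> Ccr"
  shows "integrable H v"
proof -
  obtain K where K: "continuous_on UNIV v" "compact K" "\<And>x. x \<notin> K \<Longrightarrow> v x = 0"
    using assms unfolding Ccr_def by blast
  obtain B where B: "\<And>x. \<bar>v x\<bar> \<le> B" using C0_bounded Ccr_subset_C0 assms by blast
  show ?thesis
  proof (rule integrableI_bounded_set)
    show "K \<in> sets H" using K(2) by (simp add: haar_sets borel_compact)
    show "v \<in> borel_measurable H"
      by (intro haar_measurable borel_measurable_continuous_onI K(1))
    show "emeasure H K < \<infinity>" using haar K(2) by (simp add: haar_measure_def)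
  qed (use B K(3) in auto)
qed

lemma haar_translate: "E \<in> sets borel \<Longrightarrow> emeasure H ((+) x ` E) = emeasure H E"
  using haar unfolding haar_measure_def by blast

lemma haar_integral_translate:
  fixes f :: "'a \<Rightarrow> real"
  assumes "f \<in> borel_measurable borel"
  shows "(\<integral>y. f (x + y) \<partial>H) = (\<integral>y. f y \<partial>H)"
proof -
  have cont: "(+) x \<in> borel_measurable borel"
    by (intro borel_measurable_continuous_onI continuous_intros)
  have "distr H H ((+) x) = H"
  proof (rule measure_eqI)
    fix E assume "E \<in> sets (distr H H ((+) x))"
    then have E: "E \<in> sets borel" by (simp add: haar_sets)
    have "(+) x -` E = (+) (- x) ` E"
      by (force simp: image_iff)
    moreover have "emeasure (distr H H ((+) x)) E = emeasure H ((+) x -` E)"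
      using E cont
      by (subst emeasure_distr) (auto simp: haar_sets haar_space measurable_cong_sets[OF haar_sets haar_sets])
    ultimately show "emeasure (distr H H ((+) x)) E = emeasure H E"
      using haar_translate[OF E, of "- x"] by simp
  qed simp
  then have "(\<integral>y. f y \<partial>H) = (\<integral>y. f y \<partial>distr H H ((+) x))" by simp
  also have "\<dots> = (\<integral>y. f (x + y) \<partial>H)"
    using cont assms
    by (intro integral_distr) (auto simp: measurable_cong_sets[OF haar_sets haar_sets] haar_measurable)
  finally show ?thesis by simp
qed

lemma Ccr_measurable: "v \<in> Ccr \<Longrightarrow> v \<in> borel_measurable borel"
  by (elim CcrE) (rule borel_measurable_continuous_onI)

lemma cross_corr_diff:
  assumes "a \<in> Ccr" "b \<in> Ccr"
  shows "cross_corr H a b (s - t) = (\<integral>y. a (y - s) * b (y - t) \<partial>H)"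
proof -
  have "(\<integral>y. a (- t + y - (s - t)) * b (- t + y) \<partial>H) = cross_corr H a b (s - t)"
    unfolding cross_corr_def
    by (rule haar_integral_translate[of "\<lambda>y. a (y - (s - t)) * b y"])
       (intro Ccr_measurable Ccr_mult Ccr_translate assms)
  then show ?thesis by (simp add: algebra_simps)
qed

lemma cross_corr_minus:
  assumes "a \<in> Ccr" "b \<in> Ccr"
  shows "cross_corr H a b (- x) = cross_corr H b a x"
  using cross_corr_diff[OF assms, of 0 x] by (simp add: cross_corr_def mult.commute)

text \<open>The support lies in the differences of the two supports. Continuity rests on a being
  continuous uniformly along the compact set L carrying b, a tube-lemma argument that avoids
  metrics.\<close>

lemma cross_corr_Ccr:
  assumes a: "a \<in> Ccr" and b: "b \<in> Ccr"
  shows "cross_corr H a b \<in> Ccr"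
proof -
  obtain K where K: "continuous_on UNIV a" "compact K" "\<And>x. x \<notin> K \<Longrightarrow> a x = 0"
    using a unfolding Ccr_def by blast
  obtain L where L: "continuous_on UNIV b" "compact L" "\<And>x. x \<notin> L \<Longrightarrow> b x = 0"
    using b unfolding Ccr_def by blast
  show ?thesis
  proof (rule CcrI)
    show "compact ((\<lambda>z. fst z - snd z) ` (L \<times> K))"
      by (intro compact_continuous_image compact_Times K L continuous_intros)
    fix x assume x: "x \<notin> (\<lambda>z. fst z - snd z) ` (L \<times> K)"
    have "a (y - x) * b y = 0" for y
    proof (rule ccontr)
      assume "a (y - x) * b y \<noteq> 0"
      then have "(y, y - x) \<in> L \<times> K" using K(3) L(3) by force
      then show False using x by (force simp: image_iff)
    qed
    then have "(\<lambda>y. a (y - x) * b y) = (\<lambda>_. 0)" by (rule ext)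
    then show "cross_corr H a b x = 0" by (simp only: cross_corr_def) simp
  next
    define C where "C = (\<integral>y. \<bar>b y\<bar> \<partial>H)"
    have int_b: "integrable H (\<lambda>y. \<bar>b y\<bar>)" using Ccr_integrable[OF b] by simp
    have C: "0 \<le> C" unfolding C_def by simp
    have int: "integrable H (\<lambda>y. a (y - x) * b y)" for x
      by (intro Ccr_integrable Ccr_mult Ccr_translate a b)
    show "continuous_on UNIV (cross_corr H a b)"
      unfolding continuous_on_def
    proof (intro ballI tendstoI)
      fix x0 :: 'a and \<epsilon> :: real assume "0 < \<epsilon>"
      define e where "e = \<epsilon> / (C + 1)"
      have e: "0 < e" "e * (C + 1) = \<epsilon>" using \<open>0 < \<epsilon>\<close> C by (auto simp: e_def)
      have cont: "continuous_on (UNIV \<times> L) (\<lambda>z. a (snd z - fst z))"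
        by (rule continuous_on_compose2[OF K(1)]) (auto intro!: continuous_intros)
      obtain X0 where X0: "x0 \<in> X0" "open X0"
        and X0': "\<forall>x\<in>X0 \<inter> UNIV. \<forall>y\<in>L. dist (a (snd (x, y) - fst (x, y))) (a (snd (x0, y) - fst (x0, y))) \<le> e"
        using continuous_on_prod_compactE[OF cont L(2) UNIV_I e(1)] by blast
      have "dist (cross_corr H a b x) (cross_corr H a b x0) < \<epsilon>" if "x \<in> X0" for x
      proof -
        have "cross_corr H a b x - cross_corr H a b x0 = (\<integral>y. a (y - x) * b y - a (y - x0) * b y \<partial>H)"
          unfolding cross_corr_def by (rule Bochner_Integration.integral_diff[symmetric]) (rule int)+
        also have "\<bar>\<dots>\<bar> \<le> (\<integral>y. \<bar>a (y - x) * b y - a (y - x0) * b y\<bar> \<partial>H)"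
          by (rule integral_abs_bound)
        also have "\<dots> \<le> (\<integral>y. e * \<bar>b y\<bar> \<partial>H)"
        proof (rule integral_mono)
          fix y
          show "\<bar>a (y - x) * b y - a (y - x0) * b y\<bar> \<le> e * \<bar>b y\<bar>"
          proof (cases "y \<in> L")
            case True
            then have "\<bar>a (y - x) - a (y - x0)\<bar> \<le> e" using X0' that by (auto simp: dist_real_def)
            then have "\<bar>a (y - x) - a (y - x0)\<bar> * \<bar>b y\<bar> \<le> e * \<bar>b y\<bar>" by (rule mult_right_mono) simp
            then show ?thesis by (simp add: left_diff_distrib flip: abs_mult)
          qed (simp add: L(3))
        qed (use int int_b in auto)
        also have "\<dots> = e * C" by (simp add: C_def)
        also have "\<dots> < \<epsilon>" using e by (simp add: distrib_left)
        finally show ?thesis by (simp add: dist_real_def)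
      qed
      then show "\<forall>\<^sub>F x in at x0. dist (cross_corr H a b x) (cross_corr H a b x0) < \<epsilon>"
        using X0 eventually_at_topological by blast
    qed
  qed
qed

text \<open>The function below is a Gram kernel of translates of \<open>v\<close>, smeared by \<open>M\<close>.\<close>

lemma pos_def_smeared_corr:
  assumes v: "v \<in> Ccr" and M: "psd_on E M" and E: "finite E"
  shows "pos_def (\<lambda>x. \<Sum>s\<in>E. \<Sum>t\<in>E. M s t * cross_corr H v v (x - (s - t)))" (is "pos_def ?F")
  unfolding pos_def_def psd_on_def
proof (intro allI impI conjI ballI)
  fix T :: "'a set" and x y assume "x \<in> T" "y \<in> T"
  have "cross_corr H v v (x - y - (s - t)) = cross_corr H v v (y - x - (t - s))" for s t
    using cross_corr_minus[OF v v, of "x - y - (s - t)"] by (simp add: algebra_simps)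
  then have "?F (x - y) = (\<Sum>s\<in>E. \<Sum>t\<in>E. M t s * cross_corr H v v (y - x - (t - s)))"
    using psd_on_sym[OF M] by (auto intro!: sum.cong)
  also have "\<dots> = ?F (y - x)" by (rule sum.swap)
  finally show "?F (x - y) = ?F (y - x)" .
next
  fix T :: "'a set" and c :: "'a \<Rightarrow> real" assume T: "finite T"
  \<comment> \<open>For fixed z the numbers \<open>A s z\<close> form the vector on which M is
    tested, so the final integrand is nonnegative pointwise.\<close>
  define A where "A s z = (\<Sum>x\<in>T. c x * v (z - (x + s)))" for s z
  have A: "A s \<in> Ccr" for s
    unfolding A_def by (intro Ccr_sum Ccr_cmult Ccr_translate v)
  have gram: "(\<Sum>x\<in>T. \<Sum>y\<in>T. c x * c y * cross_corr H v v (x - y - (s - t))) = (\<integral>z. A t z * A s z \<partial>H)" for s t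
  proof -
    have "(\<integral>z. A t z * A s z \<partial>H)
        = (\<integral>z. (\<Sum>x\<in>T. \<Sum>y\<in>T. c x * c y * (v (z - (x + t)) * v (z - (y + s)))) \<partial>H)"
      unfolding A_def sum_product by (simp add: mult_ac)
    also have "\<dots> = (\<Sum>x\<in>T. \<Sum>y\<in>T. c x * c y * (\<integral>z. v (z - (x + t)) * v (z - (y + s)) \<partial>H))"
    proof -
      have i: "integrable H (\<lambda>z. c x * c y * (v (z - (x + t)) * v (z - (y + s))))" for x y
        by (intro Ccr_integrable Ccr_cmult Ccr_mult Ccr_translate v)
      show ?thesis
        by (simp only: Bochner_Integration.integral_sum Bochner_Integration.integrable_sum i
            integral_mult_right_zero)
    qed
    also have "\<dots> = (\<Sum>x\<in>T. \<Sum>y\<in>T. c x * c y * cross_corr H v v (x - y - (s - t)))"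
      by (intro sum.cong refl) (simp add: cross_corr_diff[OF v v, symmetric] algebra_simps)
    finally show ?thesis ..
  qed
  have "(\<Sum>x\<in>T. \<Sum>y\<in>T. c x * c y * ?F (x - y))
      = (\<Sum>x\<in>T. \<Sum>y\<in>T. \<Sum>s\<in>E. \<Sum>t\<in>E. M s t * (c x * c y * cross_corr H v v (x - y - (s - t))))"
    by (simp add: sum_distrib_left mult_ac)
  also have "\<dots> = (\<Sum>s\<in>E. \<Sum>t\<in>E. \<Sum>x\<in>T. \<Sum>y\<in>T. M s t * (c x * c y * cross_corr H v v (x - y - (s - t))))"
    by (simp only: sum.swap[of _ E T])
  also have "\<dots> = (\<Sum>s\<in>E. \<Sum>t\<in>E. M s t * (\<integral>z. A t z * A s z \<partial>H))"
    by (simp add: gram[symmetric] sum_distrib_left)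
  also have "\<dots> = (\<integral>z. (\<Sum>s\<in>E. \<Sum>t\<in>E. A s z * A t z * M s t) \<partial>H)"
  proof -
    have i: "integrable H (\<lambda>z. M s t * (A t z * A s z))" for s t
      by (intro Ccr_integrable Ccr_cmult Ccr_mult A)
    have "(\<integral>z. (\<Sum>s\<in>E. \<Sum>t\<in>E. A s z * A t z * M s t) \<partial>H) = (\<integral>z. (\<Sum>s\<in>E. \<Sum>t\<in>E. M s t * (A t z * A s z)) \<partial>H)"
      by (simp add: mult_ac)
    also have "\<dots> = (\<Sum>s\<in>E. \<Sum>t\<in>E. M s t * (\<integral>z. A t z * A s z \<partial>H))"
      by (simp only: Bochner_Integration.integral_sum Bochner_Integration.integrable_sum i
            integral_mult_right_zero)
    finally show ?thesis ..
  qed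
  also have "\<dots> \<ge> 0"
    using psd_onD[OF M] by (intro Bochner_Integration.integral_nonneg) auto
  finally show "0 \<le> (\<Sum>x\<in>T. \<Sum>y\<in>T. c x * c y * ?F (x - y))" .
qed

lemma pos_def_cross_corr:
  assumes "v \<in> Ccr"
  shows "pos_def (cross_corr H v v)"
  using pos_def_smeared_corr[OF assms, of "{0}" "\<lambda>_ _. 1"] by (simp add: psd_on_def)

text \<open>Finitely many translates of a null open set would cover any given compact set. All
  compact sets would be null, and by inner regularity so would the whole group.\<close>

lemma haar_open_pos:
  assumes "open U" "U \<noteq> {}"
  shows "emeasure H U \<noteq> 0"
proof
  assume U0: "emeasure H U = 0"
  obtain u where u: "u \<in> U" using assms by blast
  have tr: "open ((+) x ` U)" for x
  proof -
    have "(+) x ` U = (\<lambda>y. - x + y) -` U" by (force simp: image_iff)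
    then show ?thesis
      using assms(1) by (simp only:) (intro open_vimage continuous_intros)
  qed
  have K0: "emeasure H K = 0" if K: "compact K" for K
  proof -
    have cover: "K \<subseteq> (\<Union>x\<in>K. (+) (x - u) ` U)" using u by (force simp: image_iff)
    obtain C where C: "C \<subseteq> K" "finite C" "K \<subseteq> (\<Union>x\<in>C. (+) (x - u) ` U)"
      by (rule compactE_image[OF K _ cover]) (use tr in auto)
    have b: "(+) (x - u) ` U \<in> sets H" for x using tr by (simp add: haar_sets)
    have "emeasure H K \<le> emeasure H (\<Union>x\<in>C. (+) (x - u) ` U)"
      using C b by (intro emeasure_mono) auto
    also have "\<dots> \<le> (\<Sum>x\<in>C. emeasure H ((+) (x - u) ` U))"
      using C b by (intro emeasure_subadditive_finite) auto
    also have "\<dots> = 0"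
      using U0 assms(1) by (simp add: haar_translate)
    finally show ?thesis by simp
  qed
  have "emeasure H UNIV = (SUP K\<in>{K. compact K \<and> K \<subseteq> UNIV}. emeasure H K)"
    using haar open_UNIV unfolding haar_measure_def by blast
  also have "\<dots> = (SUP K\<in>{K. compact K \<and> K \<subseteq> (UNIV :: 'a set)}. 0)" by (rule SUP_cong) (auto simp: K0)
  also have "\<dots> = 0" by (rule SUP_const) auto
  finally show False using haar unfolding haar_measure_def by blast
qed

lemma Ccr_square_integral_pos:
  assumes v: "v \<in> Ccr" and "v x \<noteq> 0"
  shows "0 < (\<integral>y. v y * v y \<partial>H)"
proof -
  have i: "integrable H (\<lambda>y. v y * v y)" by (intro Ccr_integrable Ccr_mult v)
  have U: "open {y. v y \<noteq> 0}"
    using v by (auto simp: Ccr_def intro!: open_Collect_neq continuous_intros)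
  have "(\<integral>y. v y * v y \<partial>H) \<noteq> 0"
  proof
    assume "(\<integral>y. v y * v y \<partial>H) = 0"
    then have "AE y in H. v y * v y = 0"
      using integral_nonneg_eq_0_iff_AE[OF i] by auto
    then have "AE y in H. \<not> (v y \<noteq> 0)" by simp
    then have "emeasure H {y \<in> space H. v y \<noteq> 0} = 0"
      using U by (subst (asm) AE_iff_measurable[OF _ refl]) (auto simp: haar_sets haar_space)
    then show False using haar_open_pos[OF U] assms(2) by (auto simp: haar_space)
  qed
  moreover have "0 \<le> (\<integral>y. v y * v y \<partial>H)" by (rule Bochner_Integration.integral_nonneg) auto
  ultimately show ?thesis by linarith
qed

lemma cross_corr_bounds:
  assumes v: "v \<in> Ccr" "\<And>y. 0 \<le> v y"
  shows "0 \<le> cross_corr H v v x" "cross_corr H v v x \<le> cross_corr H v v 0"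
proof -
  show "0 \<le> cross_corr H v v x"
    unfolding cross_corr_def using v(2) by (intro Bochner_Integration.integral_nonneg) auto
  have "2 * \<bar>cross_corr H v v (x - 0)\<bar> \<le> cross_corr H v v (x - x) + cross_corr H v v (0 - 0)"
    using pos_def_cross_corr[OF v(1)]
    by (intro psd_on_abs_le[of "{x, 0}" "\<lambda>x y. cross_corr H v v (x - y)"]) (auto simp: pos_def_def)
  then show "cross_corr H v v x \<le> cross_corr H v v 0" by simp
qed

section \<open>Bump functions and approximate point evaluations\<close>

context
  assumes lc: "locally_compact_space (euclidean :: 'a topology)"
begin

text \<open>Locally compact Hausdorff spaces are completely regular. Separating 0 from the
  complement of U \<inter> N, with U inside a compact set, gives both support conditions.\<close>

lemma Ccr_bump:
  assumes N: "open N" "0 \<in> N"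
  obtains v :: "'a \<Rightarrow> real" where "v \<in> Ccr" "\<And>x. 0 \<le> v x" "v 0 = 1" "\<And>x. v x \<noteq> 0 \<Longrightarrow> x \<in> N"
proof -
  have haus: "Hausdorff_space (euclidean :: 'a topology)"
    unfolding Hausdorff_space_def using hausdorff by (fastforce simp: disjnt_def)
  obtain U K where UK: "open U" "compact K" "0 \<in> U" "U \<subseteq> (K :: 'a set)"
    using lc[unfolded locally_compact_space_def, rule_format, of 0] by auto
  have "completely_regular_space (euclidean :: 'a topology)"
    by (rule locally_compact_regular_imp_completely_regular_space) (use lc haus in auto)
  moreover have "closedin euclidean (- (U \<inter> N))" "0 \<in> topspace euclidean - (- (U \<inter> N))"
    using UK N by (auto intro!: closed_Compl)
  ultimately obtain f :: "'a \<Rightarrow> real" where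
    f: "continuous_map euclidean (top_of_set {0..1}) f" "f 0 = 0" "f ` (- (U \<inter> N)) \<subseteq> {1}"
    unfolding completely_regular_space_def by metis
  have cont: "continuous_on UNIV f" and range: "\<And>x. f x \<in> {0..1}"
    using f(1) by (auto simp: continuous_map_in_subtopology image_subset_iff)
  show ?thesis
  proof (rule that[of "\<lambda>x. 1 - f x"])
    have out: "f x = 1" if "x \<notin> U \<inter> N" for x using f(3) that by blast
    show "(\<lambda>x. 1 - f x) \<in> Ccr"
      by (rule CcrI[OF _ UK(2)]) (use cont out UK(4) in \<open>auto intro!: continuous_intros\<close>)
    show "x \<in> N" if "1 - f x \<noteq> 0" for x using out[of x] that by auto
  qed (use f range in auto)
qed

text \<open>The bump is so narrow that its autocorrelation vanishes at all nonzero differences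
  between the finite set X, which carries almost all of p, and the evaluation points. The term at t
  survives with factor 1; the rest belongs to the tail off X.\<close>

lemma approximate_point_evaluation:
  assumes p: "p summable_on UNIV" and T: "finite T" and \<epsilon>: "0 < \<epsilon>"
  obtains v :: "'a \<Rightarrow> real" where "v \<in> Ccr" "\<And>x. 0 \<le> v x" "cross_corr H v v 0 = 1"
    "\<And>t. t \<in> T \<Longrightarrow> \<bar>(\<Sum>\<^sub>\<infinity>x. p x * cross_corr H v v (x - t)) - p t\<bar> \<le> \<epsilon>"
proof -
  obtain X where X: "finite X" "(\<Sum>\<^sub>\<infinity>x\<in>-X. \<bar>p x\<bar>) \<le> \<epsilon>"
    using summable_on_tail[OF p \<epsilon>] by blast
  \<comment> \<open>Without 0 this finite set is closed and misses 0, so by continuity of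
    subtraction 0 has neighbourhoods A and B with no differences in D.\<close>
  define D where "D = (\<lambda>(x, t). x - t) ` (X \<times> T) - {0}"
  have "finite D" using X T by (simp add: D_def)
  then have "open (- D)" by (rule open_Compl[OF finite_imp_closed])
  then have "open ((\<lambda>z. fst z - snd z) -` (- D) :: ('a \<times> 'a) set)"
    by (rule open_vimage) (intro continuous_intros)
  moreover have "(0, 0) \<in> (\<lambda>z. fst z - snd z) -` (- D)" by (simp add: D_def)
  ultimately obtain A B where AB: "open A" "open B" "0 \<in> A" "0 \<in> B"
    "A \<times> B \<subseteq> (\<lambda>z. fst z - snd z) -` (- D)"
    by (rule open_prod_elim) auto
  obtain w :: "'a \<Rightarrow> real" where w: "w \<in> Ccr" "\<And>x. 0 \<le> w x" "w 0 = 1" "\<And>x. w x \<noteq> 0 \<Longrightarrow> x \<in> A \<inter> B"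
    using Ccr_bump[of "A \<inter> B"] AB by blast
  define I where "I = (\<integral>y. w y * w y \<partial>H)"
  have I: "0 < I" unfolding I_def by (rule Ccr_square_integral_pos[OF w(1), of 0]) (simp add: w)
  \<comment> \<open>Scaled so that the autocorrelation is 1 at 0, and hence between 0 and 1
    everywhere.\<close>
  define v where "v x = 1 / sqrt I * w x" for x
  have v: "v \<in> Ccr" unfolding v_def by (rule Ccr_cmult[OF w(1)])
  have v0: "0 \<le> v x" for x using w(2) I by (simp add: v_def)
  have norm: "cross_corr H v v 0 = 1"
  proof -
    have "cross_corr H v v 0 = (\<integral>y. 1 / I * (w y * w y) \<partial>H)"
      unfolding cross_corr_def v_def using I by (simp add: field_simps)
    also have "\<dots> = 1 / I * I" unfolding I_def by (rule integral_mult_right_zero)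
    finally show ?thesis using I by simp
  qed
  have supp: "cross_corr H v v d = 0" if "d \<in> D" for d
  proof -
    have "v (y - d) * v y = 0" for y
    proof (rule ccontr)
      assume "v (y - d) * v y \<noteq> 0"
      then have "(y, y - d) \<in> A \<times> B" using w(4) by (auto simp: v_def)
      then have "y - (y - d) \<in> - D" using AB(5) by auto
      then show False using that by simp
    qed
    then have "(\<lambda>y. v (y - d) * v y) = (\<lambda>_. 0)" by (rule ext)
    then show ?thesis by (simp only: cross_corr_def) simp
  qed
  have "\<bar>(\<Sum>\<^sub>\<infinity>x. p x * cross_corr H v v (x - t)) - p t\<bar> \<le> \<epsilon>" if t: "t \<in> T" for t
  proof -
    have abs: "(\<lambda>x. \<bar>p x\<bar>) summable_on A" for A
      by (rule summable_on_subset_banach[OF summable_on_abs[OF p]]) auto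
    have le: "\<bar>p x * cross_corr H v v (x - t)\<bar> \<le> \<bar>p x\<bar>" for x
      using cross_corr_bounds[OF v v0, of "x - t"] norm by (simp add: abs_mult mult_left_le)
    have sum: "(\<lambda>x. p x * cross_corr H v v (x - t)) summable_on A" for A
      by (rule summable_on_abs_le[OF abs le])
    have "(\<Sum>\<^sub>\<infinity>x. p x * cross_corr H v v (x - t))
        = (\<Sum>\<^sub>\<infinity>x\<in>{t}. p x * cross_corr H v v (x - t)) + (\<Sum>\<^sub>\<infinity>x\<in>-{t}. p x * cross_corr H v v (x - t))"
      by (subst infsum_Un_disjoint[symmetric]) (auto intro: sum)
    also have "(\<Sum>\<^sub>\<infinity>x\<in>{t}. p x * cross_corr H v v (x - t)) = p t" by (simp add: norm)
    also have "(\<Sum>\<^sub>\<infinity>x\<in>-{t}. p x * cross_corr H v v (x - t))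
        = (\<Sum>\<^sub>\<infinity>x\<in>-{t} - X. p x * cross_corr H v v (x - t))"
      by (rule infsum_cong_neutral) (use supp t in \<open>force simp: D_def\<close>)+
    finally have "\<bar>(\<Sum>\<^sub>\<infinity>x. p x * cross_corr H v v (x - t)) - p t\<bar>
        = \<bar>\<Sum>\<^sub>\<infinity>x\<in>-{t} - X. p x * cross_corr H v v (x - t)\<bar>" by simp
    also have "\<dots> \<le> (\<Sum>\<^sub>\<infinity>x\<in>-{t} - X. \<bar>p x\<bar>)"
      by (rule abs_infsum_le[OF abs le])
    also have "\<dots> \<le> (\<Sum>\<^sub>\<infinity>x\<in>-X. \<bar>p x\<bar>)"
      by (rule infsum_mono2[OF abs abs]) auto
    finally show ?thesis using X(2) by simp
  qed
  with that v v0 norm show ?thesis by blast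
qed

lemma approximate_smeared_evaluation:
  assumes p: "p summable_on UNIV" and E: "finite E" and \<epsilon>: "0 < \<epsilon>"
  obtains v :: "'a \<Rightarrow> real" where "v \<in> Ccr" "\<And>x. 0 \<le> v x"
    "\<bar>(\<Sum>\<^sub>\<infinity>x. p x * (\<Sum>s\<in>E. \<Sum>t\<in>E. M s t * cross_corr H v v (x - (s - t))))
      - (\<Sum>s\<in>E. \<Sum>t\<in>E. M s t * p (s - t))\<bar> \<le> \<epsilon>"
proof -
  define C where "C = (\<Sum>s\<in>E. \<Sum>t\<in>E. \<bar>M s t\<bar>)"
  have C: "0 \<le> C" unfolding C_def by (intro sum_nonneg) auto
  define \<delta> where "\<delta> = \<epsilon> / (C + 1)"
  have \<delta>: "0 < \<delta>" "\<delta> * (C + 1) = \<epsilon>" using C \<epsilon> by (auto simp: \<delta>_def)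
  obtain v :: "'a \<Rightarrow> real" where v: "v \<in> Ccr" "\<And>x. 0 \<le> v x" "cross_corr H v v 0 = 1"
    and ap: "\<And>t. t \<in> (\<lambda>(s, t). s - t) ` (E \<times> E) \<Longrightarrow> \<bar>(\<Sum>\<^sub>\<infinity>x. p x * cross_corr H v v (x - t)) - p t\<bar> \<le> \<delta>"
    using approximate_point_evaluation[OF p _ \<delta>(1), of "(\<lambda>(s, t). s - t) ` (E \<times> E)"] E by auto
  have sum: "(\<lambda>x. p x * cross_corr H v v (x - t)) summable_on UNIV" for t
    by (rule summable_on_abs_le[OF summable_on_abs[OF p]])
       (use cross_corr_bounds[OF v(1,2)] v(3) in \<open>simp add: abs_mult mult_left_le\<close>)
  have "(\<Sum>\<^sub>\<infinity>x. p x * (\<Sum>s\<in>E. \<Sum>t\<in>E. M s t * cross_corr H v v (x - (s - t))))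
      = (\<Sum>\<^sub>\<infinity>x. \<Sum>s\<in>E. \<Sum>t\<in>E. M s t * (p x * cross_corr H v v (x - (s - t))))"
    by (simp add: sum_distrib_left mult_ac)
  also have "\<dots> = (\<Sum>s\<in>E. \<Sum>t\<in>E. M s t * (\<Sum>\<^sub>\<infinity>x. p x * cross_corr H v v (x - (s - t))))"
    by (rule infsumI) (intro has_sum_sum has_sum_cmult_right has_sum_infsum sum)
  finally have eq: "(\<Sum>\<^sub>\<infinity>x. p x * (\<Sum>s\<in>E. \<Sum>t\<in>E. M s t * cross_corr H v v (x - (s - t))))
      - (\<Sum>s\<in>E. \<Sum>t\<in>E. M s t * p (s - t))
      = (\<Sum>s\<in>E. \<Sum>t\<in>E. M s t * ((\<Sum>\<^sub>\<infinity>x. p x * cross_corr H v v (x - (s - t))) - p (s - t)))"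
    by (simp add: right_diff_distrib sum_subtractf)
  have "\<bar>\<dots>\<bar> \<le> (\<Sum>s\<in>E. \<Sum>t\<in>E. \<bar>M s t\<bar> * \<delta>)"
    by (intro order_trans[OF sum_abs] sum_mono) (auto simp: abs_mult intro!: mult_left_mono ap)
  also have "\<dots> = C * \<delta>" by (simp add: C_def sum_distrib_right)
  also have "\<dots> \<le> \<epsilon>" using \<delta> by (simp add: algebra_simps)
  finally show ?thesis using that[OF v(1,2)] eq by simp
qed

end

end

section \<open>Positive definite functions and measures of positive type\<close>

text \<open>Reindexing by negation; both steps respect the default value 0 that
  \<open>infsum\<close> takes on functions that are not summable.\<close>

lemma infsum_odd:
  fixes h :: "'a::ab_group_add \<Rightarrow> real"
  assumes "\<And>x. h (- x) = - h x"
  shows "infsum h UNIV = 0"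
proof -
  have "infsum h UNIV = (\<Sum>\<^sub>\<infinity>x. h (- x))"
    by (rule infsum_reindex_bij_betw[symmetric]) (rule bij_uminus)
  also have "\<dots> = - infsum h UNIV" using assms by (simp add: infsum_uminus)
  finally show ?thesis by simp
qed

lemma positive_definite_imp_pos_def:
  fixes f :: "'a::ab_group_add \<Rightarrow> real"
  assumes "positive_definite (\<lambda>x. complex_of_real (f x))"
  shows "pos_def f"
proof -
  have pd: "(\<Sum>j<n. \<Sum>k<n. c j * cnj (c k) * complex_of_real (f (x j - x k))) \<in> \<real>\<^sub>\<ge>\<^sub>0"
    for n :: nat and c x
    using assms by (simp add: positive_definite_def)
  \<comment> \<open>The coefficients 1 at y and i at 0 make f (- y) - f y the imaginary part of the
    sum, which has to vanish.\<close>
  have even: "f (- y) = f y" for y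
    using pd[of "\<lambda>j. if j = 0 then 1 else \<i>" "\<lambda>j. if j = 0 then y else 0" 2]
    by (simp add: numeral_2_eq_2 complex_nonneg_Reals_iff)
  show ?thesis
    unfolding pos_def_def psd_on_def
  proof (intro allI impI conjI ballI)
    fix E :: "'a set" and c :: "'a \<Rightarrow> real" assume "finite E"
    then obtain e where e: "bij_betw e {..<card E} E"
      using ex_bij_betw_nat_finite[of E] by (auto simp: atLeast0LessThan)
    have "(\<Sum>x\<in>E. \<Sum>y\<in>E. c x * c y * f (x - y))
        = (\<Sum>j<card E. \<Sum>k<card E. c (e j) * c (e k) * f (e j - e k))"
      by (simp only: sum.reindex_bij_betw[OF e, symmetric])
    moreover have "complex_of_real \<dots> \<in> \<real>\<^sub>\<ge>\<^sub>0"
      using pd[of "\<lambda>j. complex_of_real (c (e j))" e "card E"] by simp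
    ultimately show "0 \<le> (\<Sum>x\<in>E. \<Sum>y\<in>E. c x * c y * f (x - y))"
      by (simp add: complex_nonneg_Reals_iff)
  next
    fix x y show "f (x - y) = f (y - x)" using even[of "y - x"] by simp
  qed
qed

lemma pos_def_indexed:
  fixes f :: "'a::ab_group_add \<Rightarrow> real" and x :: "nat \<Rightarrow> 'a"
  assumes "pos_def f"
  shows "0 \<le> (\<Sum>j<n. \<Sum>k<n. a j * a k * f (x j - x k))"
proof -
  define E where "E = x ` {..<n}"
  have E: "finite E" by (simp add: E_def)
  \<comment> \<open>Points of a tuple may coincide, so coefficients at equal points are added up
    first.\<close>
  define A where "A s = (\<Sum>j\<in>{j\<in>{..<n}. x j = s}. a j)" for s
  have group: "(\<Sum>j<n. a j * g (x j)) = (\<Sum>s\<in>E. A s * g s)" for g :: "'a \<Rightarrow> real"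
  proof -
    have "(\<Sum>j<n. a j * g (x j)) = (\<Sum>s\<in>E. \<Sum>j\<in>{j\<in>{..<n}. x j = s}. a j * g (x j))"
      using E by (intro sum.group[symmetric]) (auto simp: E_def)
    also have "\<dots> = (\<Sum>s\<in>E. A s * g s)" by (simp add: A_def sum_distrib_right)
    finally show ?thesis .
  qed
  have "(\<Sum>j<n. \<Sum>k<n. a j * a k * f (x j - x k)) = (\<Sum>j<n. a j * (\<Sum>k<n. a k * f (x j - x k)))"
    by (simp add: sum_distrib_left mult.assoc)
  also have "\<dots> = (\<Sum>j<n. a j * (\<Sum>t\<in>E. A t * f (x j - t)))"
    by (simp only: group[of "\<lambda>t. f (x _ - t)"])
  also have "\<dots> = (\<Sum>s\<in>E. A s * (\<Sum>t\<in>E. A t * f (s - t)))" by (rule group)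
  also have "\<dots> = (\<Sum>s\<in>E. \<Sum>t\<in>E. A s * A t * f (s - t))"
    by (simp add: sum_distrib_left mult.assoc)
  also have "\<dots> \<ge> 0" using assms E by (intro psd_onD) (simp add: pos_def_def)
  finally show ?thesis .
qed

text \<open>The real part splits into the forms at Re c and Im c. The imaginary part changes sign
  when the indices are exchanged, because f is even.\<close>

lemma pos_def_imp_positive_definite:
  fixes f :: "'a::ab_group_add \<Rightarrow> real"
  assumes f: "pos_def f"
  shows "positive_definite (\<lambda>x. complex_of_real (f x))"
  unfolding positive_definite_def
proof (intro allI)
  fix n :: nat and c :: "nat \<Rightarrow> complex" and x :: "nat \<Rightarrow> 'a"
  let ?S = "\<Sum>j<n. \<Sum>k<n. c j * cnj (c k) * complex_of_real (f (x j - x k))"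
  have "Re ?S = (\<Sum>j<n. \<Sum>k<n. Re (c j) * Re (c k) * f (x j - x k))
      + (\<Sum>j<n. \<Sum>k<n. Im (c j) * Im (c k) * f (x j - x k))"
    by (simp add: sum.distrib distrib_right)
  moreover have "Im ?S = 0"
  proof -
    have "(\<Sum>j<n. \<Sum>k<n. Im (c j) * Re (c k) * f (x j - x k))
        = (\<Sum>j<n. \<Sum>k<n. Im (c k) * Re (c j) * f (x k - x j))" by (rule sum.swap)
    also have "\<dots> = (\<Sum>j<n. \<Sum>k<n. Re (c j) * Im (c k) * f (x j - x k))"
    proof (intro sum.cong refl)
      fix j k show "Im (c k) * Re (c j) * f (x k - x j) = Re (c j) * Im (c k) * f (x j - x k)"
        using pos_def_even[OF f, of "x j - x k"] by simp
    qed
    finally show ?thesis by (simp add: left_diff_distrib sum_subtractf)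
  qed
  ultimately show "?S \<in> \<real>\<^sub>\<ge>\<^sub>0"
    using pos_def_indexed[OF f] by (simp add: complex_nonneg_Reals_iff add_nonneg_nonneg)
qed

lemma pos_def_add: "pos_def f \<Longrightarrow> pos_def g \<Longrightarrow> pos_def (\<lambda>x. f x + g x)"
  by (simp add: pos_def_def psd_on_add)

lemma Cc_parts:
  fixes u :: "'a::topological_ab_group_add \<Rightarrow> complex"
  assumes "u \<in> Cc"
  shows "(\<lambda>y. Re (u (- y))) \<in> Ccr" "(\<lambda>y. Im (u (- y))) \<in> Ccr"
proof -
  have u: "continuous_on UNIV u" "compact (closure {x. u x \<noteq> 0})" using assms by (auto simp: Cc_def)
  have 0: "u x = 0" if "x \<notin> closure {x. u x \<noteq> 0}" for x
    using that closure_subset[of "{x. u x \<noteq> 0}"] by auto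
  have "(\<lambda>y. Re (u y)) \<in> Ccr"
    by (rule CcrI[OF continuous_on_Re[OF u(1)] u(2)]) (drule 0, simp)
  then show "(\<lambda>y. Re (u (- y))) \<in> Ccr" by (rule Ccr_reflect)
  have "(\<lambda>y. Im (u y)) \<in> Ccr"
    by (rule CcrI[OF continuous_on_Im[OF u(1)] u(2)]) (drule 0, simp)
  then show "(\<lambda>y. Im (u (- y))) \<in> Ccr" by (rule Ccr_reflect)
qed

lemma summable_on_mult_C0:
  fixes p f :: "'b::topological_space \<Rightarrow> real"
  assumes "p summable_on UNIV" "f \<in> C0"
  shows "(\<lambda>x. p x * f x) summable_on UNIV"
proof -
  obtain B where B: "\<And>x. \<bar>f x\<bar> \<le> B" using C0_bounded[OF assms(2)] by blast
  show ?thesis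
    by (rule summable_on_abs_le[OF summable_on_cmult_left[OF summable_on_abs[OF assms(1)], of B]])
       (use B in \<open>simp add: abs_mult mult_left_mono\<close>)
qed

lemma real_measure_integral_C0:
  fixes p f :: "'b::t2_space \<Rightarrow> real"
  assumes "p summable_on UNIV" "f \<in> C0"
  shows "real_measure_integral (point_masses p) f = (\<Sum>\<^sub>\<infinity>x. p x * f x)"
proof -
  obtain B where "\<And>x. \<bar>f x\<bar> \<le> B" using C0_bounded[OF assms(2)] by blast
  then show ?thesis
    using real_measure_integral_point_masses(2)[OF assms(1), of f B] assms(2)
    by (simp add: C0_def borel_measurable_continuous_onI)
qed

section \<open>Autocorrelations of complex test functions\<close>

context
  fixes H :: "'a::{topological_ab_group_add, t2_space} measure"
  assumes haar: "haar_measure H"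
begin

text \<open>a and b are the parts of the reflected function, so the integrand is a + i b at y - x
  times a - i b at y.\<close>

lemma convolution_conj_reflection:
  assumes u: "u \<in> Cc"
  defines "a \<equiv> \<lambda>y. Re (u (- y))" and "b \<equiv> \<lambda>y. Im (u (- y))"
  shows "convolution_of H u (conj_reflection u) x =
    Complex (cross_corr H a a x + cross_corr H b b x) (cross_corr H b a x - cross_corr H a b x)"
proof -
  have ab: "a \<in> Ccr" "b \<in> Ccr" using Cc_parts[OF u] by (auto simp: a_def b_def)
  have i: "integrable H (\<lambda>y. f (y - x) * g y)" if "f \<in> Ccr" "g \<in> Ccr" for f g
    by (intro Ccr_integrable[OF haar] Ccr_mult Ccr_translate that)
  have "u (x - y) * conj_reflection u y
      = complex_of_real (a (y - x) * a y + b (y - x) * b y)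
        + \<i> * complex_of_real (b (y - x) * a y - a (y - x) * b y)" for y
    by (simp add: a_def b_def conj_reflection_def complex_eq_iff algebra_simps)
  then have "convolution_of H u (conj_reflection u) x
      = (\<integral>y. complex_of_real (a (y - x) * a y + b (y - x) * b y)
        + \<i> * complex_of_real (b (y - x) * a y - a (y - x) * b y) \<partial>H)"
    by (simp only: convolution_of_def)
  also have "\<dots> = (\<integral>y. complex_of_real (a (y - x) * a y + b (y - x) * b y) \<partial>H)
        + (\<integral>y. \<i> * complex_of_real (b (y - x) * a y - a (y - x) * b y) \<partial>H)"
    using i ab
    by (intro Bochner_Integration.integral_add integrable_mult_right integrable_of_real
        Bochner_Integration.integrable_add Bochner_Integration.integrable_diff)
  also have "\<dots> = complex_of_real (\<integral>y. a (y - x) * a y + b (y - x) * b y \<partial>H)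
        + \<i> * complex_of_real (\<integral>y. b (y - x) * a y - a (y - x) * b y \<partial>H)"
    by (simp only: integral_mult_right_zero integral_complex_of_real)
  also have "(\<integral>y. a (y - x) * a y + b (y - x) * b y \<partial>H) = cross_corr H a a x + cross_corr H b b x"
    unfolding cross_corr_def using i ab by (intro Bochner_Integration.integral_add)
  also have "(\<integral>y. b (y - x) * a y - a (y - x) * b y \<partial>H) = cross_corr H b a x - cross_corr H a b x"
    unfolding cross_corr_def using i ab by (intro Bochner_Integration.integral_diff)
  finally show ?thesis by (simp add: Complex_eq)
qed

lemma real_measure_integral_convolution:
  assumes p: "p summable_on UNIV" and u: "u \<in> Cc"
  defines "a \<equiv> \<lambda>y. Re (u (- y))" and "b \<equiv> \<lambda>y. Im (u (- y))"
  defines "I \<equiv> real_measure_integral (point_masses p) (convolution_of H u (conj_reflection u))"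
  shows "Re I = (\<Sum>\<^sub>\<infinity>x. p x * (cross_corr H a a x + cross_corr H b b x))"
    and "Im I = (\<Sum>\<^sub>\<infinity>x. p x * (cross_corr H b a x - cross_corr H a b x))"
proof -
  have ab: "a \<in> Ccr" "b \<in> Ccr" using Cc_parts[OF u] by (auto simp: a_def b_def)
  define R where "R x = cross_corr H a a x + cross_corr H b b x" for x
  define J where "J x = cross_corr H b a x + (-1) * cross_corr H a b x" for x
  have RJ: "R \<in> Ccr" "J \<in> Ccr"
    unfolding R_def J_def by (intro Ccr_add Ccr_cmult cross_corr_Ccr[OF haar] ab)+
  have eq: "convolution_of H u (conj_reflection u) = (\<lambda>x. Complex (R x) (J x))"
    by (rule ext) (simp add: convolution_conj_reflection[OF u] R_def J_def a_def b_def)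
  obtain B C where BC: "\<And>x. \<bar>R x\<bar> \<le> B" "\<And>x. \<bar>J x\<bar> \<le> C"
    using C0_bounded RJ Ccr_subset_C0 by (metis subsetD)
  have cont: "continuous_on UNIV (\<lambda>x. Complex (R x) (J x))"
    using RJ by (auto simp: Ccr_def Complex_eq intro!: continuous_intros)
  have bdd: "norm (Complex (R x) (J x)) \<le> B + C" for x
    using cmod_le[of "Complex (R x) (J x)"] BC(1)[of x] BC(2)[of x] by simp
  note int = real_measure_integral_point_masses[OF p borel_measurable_continuous_onI[OF cont] bdd]
  have I: "I = (\<Sum>\<^sub>\<infinity>x. p x *\<^sub>R Complex (R x) (J x))" unfolding I_def eq by (rule int(2))
  show "Re I = (\<Sum>\<^sub>\<infinity>x. p x * (cross_corr H a a x + cross_corr H b b x))"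
    using infsum_Re[OF int(1)] by (simp add: I R_def)
  show "Im I = (\<Sum>\<^sub>\<infinity>x. p x * (cross_corr H b a x - cross_corr H a b x))"
    using infsum_Im[OF int(1)] by (simp add: I J_def)
qed

text \<open>In the real part p meets a sum of two autocorrelations, which is positive definite. In
  the imaginary part the even p meets an odd difference of cross-correlations.\<close>

lemma pos_def_imp_positive_type:
  assumes p: "p summable_on UNIV" and pd: "pos_def p"
  shows "positive_type H (point_masses p)"
  unfolding positive_type_def complex_nonneg_Reals_iff
proof (intro ballI conjI)
  fix u :: "'a \<Rightarrow> complex" assume u: "u \<in> Cc"
  define a where "a y = Re (u (- y))" for y
  define b where "b y = Im (u (- y))" for y
  have ab: "a \<in> Ccr" "b \<in> Ccr" using Cc_parts[OF u] by (auto simp: a_def[abs_def] b_def[abs_def])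
  note int = real_measure_integral_convolution[OF p u, folded a_def[abs_def] b_def[abs_def]]
  have "(\<lambda>x. cross_corr H a a x + cross_corr H b b x) \<in> C0"
    by (intro subsetD[OF Ccr_subset_C0] Ccr_add cross_corr_Ccr[OF haar] ab)
  then show "0 \<le> Re (real_measure_integral (point_masses p) (convolution_of H u (conj_reflection u)))"
    unfolding int(1)
    by (intro infsum_pos_def_mult_nonneg pos_def_add pos_def_cross_corr[OF haar] summable_on_mult_C0 pd p ab)
  have "(\<Sum>\<^sub>\<infinity>x. p x * (cross_corr H b a x - cross_corr H a b x)) = 0"
    by (rule infsum_odd)
       (simp add: pos_def_even[OF pd] cross_corr_minus[OF haar] ab right_diff_distrib)
  then show "Im (real_measure_integral (point_masses p) (convolution_of H u (conj_reflection u))) = 0"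
    by (simp only: int(2))
qed

context
  assumes lc: "locally_compact_space (euclidean :: 'a topology)"
begin

text \<open>The weights \<open>c s * c t\<close> are symmetric, so the form they define sees only
  the even part of p; hence the symmetrisation in the conclusion.\<close>

lemma positive_type_imp_pos_def:
  assumes p: "p summable_on UNIV" and pt: "positive_type H (point_masses p)"
  shows "pos_def (\<lambda>x. (p x + p (- x)) / 2)"
  unfolding pos_def_def psd_on_def
proof (intro allI impI conjI ballI)
  fix E :: "'a set" and x y
  show "(p (x - y) + p (- (x - y))) / 2 = (p (y - x) + p (- (y - x))) / 2" by simp
next
  fix E :: "'a set" and c :: "'a \<Rightarrow> real" assume E: "finite E"
  define S where "S = (\<Sum>s\<in>E. \<Sum>t\<in>E. c s * c t * p (s - t))"
  have "0 \<le> S + \<epsilon>" if \<epsilon>: "0 < \<epsilon>" for \<epsilon>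
  proof -
    obtain v :: "'a \<Rightarrow> real" where v: "v \<in> Ccr" and
      ap: "\<bar>(\<Sum>\<^sub>\<infinity>x. p x * (\<Sum>s\<in>E. \<Sum>t\<in>E. c s * c t * cross_corr H v v (x - (s - t)))) - S\<bar> \<le> \<epsilon>"
      unfolding S_def
      by (rule approximate_smeared_evaluation[OF haar lc p E \<epsilon>, of "\<lambda>s t. c s * c t"])
    define A where "A z = (\<Sum>s\<in>E. c s * v (z - s))" for z
    have A: "A \<in> Ccr" unfolding A_def by (intro Ccr_sum Ccr_cmult Ccr_translate v)
    \<comment> \<open>Convolving u with its conjugate reflection correlates the reflection of u,
      here A. The autocorrelation of A is that of v smeared with the weights
      \<open>c s * c t\<close>.\<close>
    define u where "u z = complex_of_real (A (- z))" for z
    have u: "u \<in> Cc"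
    proof -
      obtain K where K: "continuous_on UNIV (\<lambda>z. A (- z))" "compact K" "\<And>x. x \<notin> K \<Longrightarrow> A (- x) = 0"
        using Ccr_reflect[OF A] unfolding Ccr_def by blast
      have "closure {x. u x \<noteq> 0} \<subseteq> K"
        by (rule closure_minimal) (use K in \<open>auto simp: u_def compact_imp_closed\<close>)
      then have "closure {x. u x \<noteq> 0} = K \<inter> closure {x. u x \<noteq> 0}" by blast
      then have "compact (closure {x. u x \<noteq> 0})"
        using compact_Int_closed[OF K(2) closed_closure] by metis
      then show ?thesis using K(1) by (simp add: Cc_def u_def[abs_def] continuous_on_of_real)
    qed
    have parts: "(\<lambda>y. Re (u (- y))) = A" "(\<lambda>y. Im (u (- y))) = (\<lambda>_. 0)" by (auto simp: u_def)
    have zero: "cross_corr H (\<lambda>_. 0) (\<lambda>_. 0) x = 0" for x by (simp add: cross_corr_def)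
    have "Re (real_measure_integral (point_masses p) (convolution_of H u (conj_reflection u)))
        = (\<Sum>\<^sub>\<infinity>x. p x * cross_corr H A A x)"
      using real_measure_integral_convolution(1)[OF p u] by (simp only: parts zero add_0_right)
    moreover have "cross_corr H A A x = (\<Sum>s\<in>E. \<Sum>t\<in>E. c s * c t * cross_corr H v v (x - (s - t)))" for x
    proof -
      have i: "integrable H (\<lambda>z. c s * c t * (v (z - (x + t)) * v (z - s)))" for s t
        by (intro Ccr_integrable[OF haar] Ccr_cmult Ccr_mult Ccr_translate v)
      have "cross_corr H A A x = (\<integral>z. (\<Sum>s\<in>E. \<Sum>t\<in>E. c s * c t * (v (z - (x + t)) * v (z - s))) \<partial>H)"
        unfolding cross_corr_def A_def sum_product
        by (subst sum.swap) (simp add: algebra_simps)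
      also have "\<dots> = (\<Sum>s\<in>E. \<Sum>t\<in>E. c s * c t * (\<integral>z. v (z - (x + t)) * v (z - s) \<partial>H))"
        by (simp only: Bochner_Integration.integral_sum Bochner_Integration.integrable_sum i
            integral_mult_right_zero)
      also have "\<dots> = (\<Sum>s\<in>E. \<Sum>t\<in>E. c s * c t * cross_corr H v v (x - (s - t)))"
      proof (intro sum.cong refl)
        fix s t
        show "c s * c t * (\<integral>z. v (z - (x + t)) * v (z - s) \<partial>H) = c s * c t * cross_corr H v v (x - (s - t))"
          using cross_corr_diff[OF haar v v, of "x + t" s] by (simp add: algebra_simps)
      qed
      finally show ?thesis .
    qed
    moreover have "0 \<le> Re (real_measure_integral (point_masses p) (convolution_of H u (conj_reflection u)))"
      using pt u unfolding positive_type_def complex_nonneg_Reals_iff by blast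
    ultimately have "0 \<le> (\<Sum>\<^sub>\<infinity>x. p x * (\<Sum>s\<in>E. \<Sum>t\<in>E. c s * c t * cross_corr H v v (x - (s - t))))"
      by simp
    then show ?thesis using ap by linarith
  qed
  then have S: "0 \<le> S" by (rule field_le_epsilon)
  \<comment> \<open>Exchanging s and t turns p into its reflection and keeps the weights, so the
    form of the even part is again S.\<close>
  have "(\<Sum>s\<in>E. \<Sum>t\<in>E. c s * c t * p (- (s - t))) = (\<Sum>t\<in>E. \<Sum>s\<in>E. c s * c t * p (- (s - t)))"
    by (rule sum.swap)
  also have "\<dots> = S" by (simp add: S_def mult.commute)
  finally have "(\<Sum>s\<in>E. \<Sum>t\<in>E. c s * c t * ((p (s - t) + p (- (s - t))) / 2)) = (S + S) / 2"
    unfolding add_divide_distrib distrib_left sum.distrib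
    by (simp add: S_def sum_divide_distrib[symmetric])
  then show "0 \<le> (\<Sum>x\<in>E. \<Sum>y\<in>E. c x * c y * ((p (x - y) + p (- (x - y))) / 2))"
    using S by simp
qed

text \<open>The smeared autocorrelation is positive definite since M is positive semidefinite. It is
  nonnegative since collecting the terms with s - t = d leaves nonnegative multiples of translates
  of a nonnegative function. So it is an admissible test function.\<close>

lemma dual_cone_test:
  fixes p :: "'a \<Rightarrow> real" and M :: "'a \<Rightarrow> 'a \<Rightarrow> real"
  assumes p: "p summable_on UNIV" and dual: "point_masses p \<in> dual_cone (P0 \<inter> D0)"
    and E: "finite E" and M: "psd_on E M"
    and g: "\<And>d. 0 \<le> (\<Sum>s\<in>E. \<Sum>t\<in>E. if s - t = d then M s t else 0)"
  shows "0 \<le> (\<Sum>s\<in>E. \<Sum>t\<in>E. M s t * p (s - t))"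
proof (rule field_le_epsilon)
  fix \<epsilon> :: real assume \<epsilon>: "0 < \<epsilon>"
  obtain v :: "'a \<Rightarrow> real" where v: "v \<in> Ccr" "\<And>x. 0 \<le> v x" and
    ap: "\<bar>(\<Sum>\<^sub>\<infinity>x. p x * (\<Sum>s\<in>E. \<Sum>t\<in>E. M s t * cross_corr H v v (x - (s - t))))
      - (\<Sum>s\<in>E. \<Sum>t\<in>E. M s t * p (s - t))\<bar> \<le> \<epsilon>"
    using approximate_smeared_evaluation[OF haar lc p E \<epsilon>, of M] by blast
  define F where "F x = (\<Sum>s\<in>E. \<Sum>t\<in>E. M s t * cross_corr H v v (x - (s - t)))" for x
  have F: "F \<in> C0"
    unfolding F_def
    by (intro subsetD[OF Ccr_subset_C0] Ccr_sum Ccr_cmult Ccr_translate cross_corr_Ccr[OF haar] v)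
  have "0 \<le> F x" for x
  proof -
    define D where "D = (\<lambda>(s, t). s - t) ` (E \<times> E)"
    have D: "finite D" "\<And>s t. s \<in> E \<Longrightarrow> t \<in> E \<Longrightarrow> s - t \<in> D" using E by (auto simp: D_def)
    have "F x = (\<Sum>s\<in>E. \<Sum>t\<in>E. \<Sum>d\<in>D. (if s - t = d then M s t else 0) * cross_corr H v v (x - d))"
      unfolding F_def
    proof (intro sum.cong refl)
      fix s t assume "s \<in> E" "t \<in> E"
      have "(\<Sum>d\<in>D. (if s - t = d then M s t else 0) * cross_corr H v v (x - d))
          = (\<Sum>d\<in>D. if s - t = d then M s t * cross_corr H v v (x - d) else 0)"
        by (rule sum.cong) auto
      then show "M s t * cross_corr H v v (x - (s - t))
          = (\<Sum>d\<in>D. (if s - t = d then M s t else 0) * cross_corr H v v (x - d))"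
        using D \<open>s \<in> E\<close> \<open>t \<in> E\<close> by simp
    qed
    also have "\<dots> = (\<Sum>d\<in>D. \<Sum>s\<in>E. \<Sum>t\<in>E. (if s - t = d then M s t else 0) * cross_corr H v v (x - d))"
      by (simp only: sum.swap[of _ D E])
    also have "\<dots> = (\<Sum>d\<in>D. (\<Sum>s\<in>E. \<Sum>t\<in>E. if s - t = d then M s t else 0) * cross_corr H v v (x - d))"
      by (simp only: sum_distrib_right)
    also have "\<dots> \<ge> 0"
      by (intro sum_nonneg mult_nonneg_nonneg g cross_corr_bounds[OF haar v])
    finally show ?thesis .
  qed
  moreover have "pos_def F"
    unfolding F_def by (rule pos_def_smeared_corr[OF haar v(1) M E])
  ultimately have "F \<in> P0 \<inter> D0"
    using F pos_def_imp_positive_definite by (auto simp: P0_def D0_def)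
  then have "0 \<le> real_measure_integral (point_masses p) F"
    using dual unfolding dual_cone_def by blast
  then have "0 \<le> (\<Sum>\<^sub>\<infinity>x. p x * F x)"
    by (simp only: real_measure_integral_C0[OF p F])
  then show "0 \<le> (\<Sum>s\<in>E. \<Sum>t\<in>E. M s t * p (s - t)) + \<epsilon>"
    using ap unfolding F_def by linarith
qed

end

end


section \<open>The decomposition\<close>

lemma summable_on_reflect:
  fixes p :: "'a::ab_group_add \<Rightarrow> real"
  assumes "p summable_on UNIV"
  shows "(\<lambda>x. p (- x)) summable_on UNIV"
  using assms summable_on_reindex_bij_betw[OF bij_uminus, of p] by blast

lemma point_masses_reflect:
  fixes p :: "'a::{topological_ab_group_add, t2_space} \<Rightarrow> real"
  assumes "E \<in> sets borel"
  shows "point_masses p (uminus ` E) = point_masses (\<lambda>x. p (- x)) E"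
proof -
  have "uminus ` E = uminus -` E" by force
  moreover have "uminus -` E \<inter> space borel \<in> sets borel"
    by (rule measurable_sets[OF _ assms]) (intro borel_measurable_continuous_onI continuous_intros)
  ultimately have "uminus ` E \<in> sets borel" by simp
  then show ?thesis
    using assms infsum_reindex[of uminus E p] by (simp add: point_masses_def comp_def inj_on_def)
qed

theorem theorem5:
  fixes H :: "'a::{topological_ab_group_add, t2_space} measure"
    and \<sigma> :: "'a set \<Rightarrow> real"
  assumes "locally_compact_space (euclidean :: 'a topology)"
    and "haar_measure H"
    and "\<sigma> \<in> real_measures"
    and "atomic_measure \<sigma>"
  shows "\<sigma> \<in> dual_cone (P0 \<inter> D0) \<longleftrightarrow>
    (\<exists>\<omega>\<in>real_measures. \<exists>\<rho>\<in>real_measures. \<exists>\<tau>\<in>real_measures.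
       nonneg_measure \<omega> \<and> atomic_measure \<omega> \<and> even_measure \<omega> \<and>
       atomic_measure \<rho> \<and> positive_type H \<rho> \<and>
       atomic_measure \<tau> \<and> odd_measure \<tau> \<and>
       \<sigma> = (\<lambda>E. \<omega> E + \<rho> E + \<tau> E))"
proof
  obtain p where p: "p summable_on UNIV" and \<sigma>: "\<sigma> = point_masses p"
    using atomic_measureE[OF assms(3,4)] .
  {
    assume dual: "\<sigma> \<in> dual_cone (P0 \<inter> D0)"
    define s where "s x = (p x + p (- x)) / 2" for x
    define q where "q x = (p x - p (- x)) / 2" for x
    have pm: "(\<lambda>x. p (- x)) summable_on UNIV" by (rule summable_on_reflect[OF p])
    have s: "s summable_on UNIV"
      unfolding s_def add_divide_distrib divide_inverse
      by (intro summable_on_add summable_on_cmult_left p pm)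
    have q: "q summable_on UNIV"
    proof -
      have "(\<lambda>x. p x - s x) summable_on UNIV"
        using summable_on_add[OF p iffD2[OF summable_on_uminus s]] by simp
      moreover have "p x - s x = q x" for x by (simp add: s_def q_def field_simps)
      ultimately show ?thesis by simp
    qed
    have even: "s (- x) = s x" for x by (simp add: s_def)
    have test: "0 \<le> (\<Sum>x\<in>E. \<Sum>y\<in>E. M x y * s (x - y))"
      if "finite E" "psd_on E M" "\<And>d. 0 \<le> (\<Sum>x\<in>E. \<Sum>y\<in>E. if x - y = d then M x y else 0)" for E M
    proof -
      let ?S = "\<Sum>x\<in>E. \<Sum>y\<in>E. M x y * p (x - y)"
      have "0 \<le> ?S" by (rule dual_cone_test[OF assms(2,1) p dual[unfolded \<sigma>] that])
      \<comment> \<open>M is symmetric, so it pairs equally with p and its reflection, and the test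
        passes to the even part s.\<close>
      moreover have "(\<Sum>x\<in>E. \<Sum>y\<in>E. M x y * p (- (x - y))) = ?S"
      proof -
        have "(\<Sum>x\<in>E. \<Sum>y\<in>E. M x y * p (- (x - y))) = (\<Sum>x\<in>E. \<Sum>y\<in>E. M y x * p (- (y - x)))"
          by (rule sum.swap)
        also have "\<dots> = ?S"
          using psd_on_sym[OF that(2)] by (auto intro!: sum.cong)
        finally show ?thesis .
      qed
      moreover have "(\<Sum>x\<in>E. \<Sum>y\<in>E. M x y * s (x - y))
          = (?S + (\<Sum>x\<in>E. \<Sum>y\<in>E. M x y * p (- (x - y)))) / 2"
        unfolding s_def by (simp add: sum.distrib sum_divide_distrib distrib_left add_divide_distrib)
      ultimately show ?thesis by simp
    qed
    obtain w where w: "\<And>x. 0 \<le> w x" "\<And>x. w (- x) = w x" "pos_def (\<lambda>x. s x - w x)"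
      using nonneg_plus_pos_def[where s = s, OF even test] by blast
    define r where "r x = s x - w x" for x
    have ws: "w summable_on UNIV" by (rule summable_on_if_pos_def_diff[OF s w(1,3)])
    have rs: "r summable_on UNIV"
      unfolding r_def using summable_on_add[OF s iffD2[OF summable_on_uminus ws]] by simp
    have "point_masses p E = point_masses w E + point_masses r E + point_masses q E" for E
    proof (cases "E \<in> sets borel")
      case True
      have sub: "f summable_on E" if "f summable_on UNIV" for f :: "'a \<Rightarrow> real"
        by (rule summable_on_subset_banach[OF that]) simp
      have "infsum p E = (\<Sum>\<^sub>\<infinity>x\<in>E. w x + r x + q x)"
        by (rule infsum_cong) (simp add: r_def s_def q_def field_simps)
      also have "\<dots> = infsum w E + infsum r E + infsum q E"
        by (simp add: infsum_add summable_on_add sub ws rs q)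
      finally show ?thesis using True by (simp add: point_masses_def)
    qed (simp add: point_masses_def)
    then have "\<sigma> = (\<lambda>E. point_masses w E + point_masses r E + point_masses q E)"
      unfolding \<sigma> by (rule ext)
    moreover have "nonneg_measure (point_masses w)"
      using w(1) by (simp add: nonneg_measure_def point_masses_def infsum_nonneg)
    moreover have "even_measure (point_masses w)"
      by (simp add: even_measure_def point_masses_reflect w(2))
    moreover have "odd_measure (point_masses q)"
    proof -
      have "q (- x) = - q x" for x by (simp add: q_def field_simps)
      then show ?thesis
        by (simp add: odd_measure_def point_masses_reflect) (simp add: point_masses_def infsum_uminus)
    qed
    moreover have "positive_type H (point_masses r)"
      using pos_def_imp_positive_type[OF assms(2) rs] w(3) unfolding r_def[abs_def] .
    ultimately show "\<exists>\<omega>\<in>real_measures. \<exists>\<rho>\<in>real_measures. \<exists>\<tau>\<in>real_measures.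
       nonneg_measure \<omega> \<and> atomic_measure \<omega> \<and> even_measure \<omega> \<and>
       atomic_measure \<rho> \<and> positive_type H \<rho> \<and>
       atomic_measure \<tau> \<and> odd_measure \<tau> \<and>
       \<sigma> = (\<lambda>E. \<omega> E + \<rho> E + \<tau> E)"
      using point_masses_in_real_measures[OF ws] point_masses_in_real_measures[OF rs]
        point_masses_in_real_measures[OF q] atomic_point_masses[OF ws]
        atomic_point_masses[OF rs] atomic_point_masses[OF q] by blast
  next
    assume "\<exists>\<omega>\<in>real_measures. \<exists>\<rho>\<in>real_measures. \<exists>\<tau>\<in>real_measures.
       nonneg_measure \<omega> \<and> atomic_measure \<omega> \<and> even_measure \<omega> \<and>
       atomic_measure \<rho> \<and> positive_type H \<rho> \<and>
       atomic_measure \<tau> \<and> odd_measure \<tau> \<and>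
       \<sigma> = (\<lambda>E. \<omega> E + \<rho> E + \<tau> E)"
    then obtain \<omega> \<rho> \<tau> where in_M: "\<omega> \<in> real_measures" "\<rho> \<in> real_measures" "\<tau> \<in> real_measures"
      and at: "atomic_measure \<omega>" "atomic_measure \<rho>" "atomic_measure \<tau>"
      and nn: "nonneg_measure \<omega>" and pt: "positive_type H \<rho>" and odd: "odd_measure \<tau>"
      and eq: "\<sigma> = (\<lambda>E. \<omega> E + \<rho> E + \<tau> E)" by blast
    obtain w where w: "w summable_on UNIV" "\<omega> = point_masses w" using atomic_measureE[OF in_M(1) at(1)] .
    obtain r where r: "r summable_on UNIV" "\<rho> = point_masses r" using atomic_measureE[OF in_M(2) at(2)] .
    obtain q where q: "q summable_on UNIV" "\<tau> = point_masses q" using atomic_measureE[OF in_M(3) at(3)] .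
    have single: "{x} \<in> sets borel" for x :: 'a by simp
    have p_eq: "p x = w x + r x + q x" for x
      using fun_cong[OF eq, of "{x}"] by (simp add: \<sigma> w r q)
    have w0: "0 \<le> w x" for x
      using nn by (auto simp: nonneg_measure_def w(2) dest: bspec[OF _ single[of x]])
    have q_odd: "q (- x) = - q x" for x
      using odd by (auto simp: odd_measure_def q(2) dest: bspec[OF _ single[of x]])
    \<comment> \<open>Positive type controls only the even part of r; its odd part joins q
      below.\<close>
    define r' where "r' x = (r x + r (- x)) / 2" for x
    have r': "pos_def r'"
      unfolding r'_def by (rule positive_type_imp_pos_def[OF assms(2,1) r(1) pt[unfolded r(2)]])
    have r's: "r' summable_on UNIV"
      unfolding r'_def add_divide_distrib divide_inverse
      by (intro summable_on_add summable_on_cmult_left r summable_on_reflect)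
    have "0 \<le> real_measure_integral \<sigma> f" if f: "f \<in> P0 \<inter> D0" for f
    proof -
      have f0: "f \<in> C0" "\<And>x. 0 \<le> f x" and fpd: "pos_def f"
        using f positive_definite_imp_pos_def by (auto simp: P0_def D0_def)
      note fs = summable_on_mult_C0[OF _ f0(1)]
      have "real_measure_integral \<sigma> f = (\<Sum>\<^sub>\<infinity>x. p x * f x)"
        unfolding \<sigma> by (rule real_measure_integral_C0[OF p f0(1)])
      also have "\<dots> = (\<Sum>\<^sub>\<infinity>x. w x * f x + r' x * f x + (p x * f x - w x * f x - r' x * f x))"
        by simp
      also have "\<dots> = (\<Sum>\<^sub>\<infinity>x. w x * f x) + (\<Sum>\<^sub>\<infinity>x. r' x * f x)
          + (\<Sum>\<^sub>\<infinity>x. p x * f x - w x * f x - r' x * f x)"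
      proof -
        have "(\<lambda>x. p x * f x + - (w x * f x) + - (r' x * f x)) summable_on UNIV"
          by (intro summable_on_add iffD2[OF summable_on_uminus] fs p w r's)
        then have rest: "(\<lambda>x. p x * f x - w x * f x - r' x * f x) summable_on UNIV" by simp
        show ?thesis
          by (simp only: infsum_add[OF summable_on_add[OF fs[OF w(1)] fs[OF r's]] rest]
              infsum_add[OF fs[OF w(1)] fs[OF r's]])
      qed
      \<comment> \<open>What remains of p is the odd part of r plus q; multiplied by the even f it
        sums to 0.\<close>
      also have "(\<Sum>\<^sub>\<infinity>x. p x * f x - w x * f x - r' x * f x) = 0"
        by (rule infsum_odd) (simp add: p_eq r'_def q_odd pos_def_even[OF fpd] field_simps)
      finally show ?thesis
        using infsum_pos_def_mult_nonneg[OF r' fpd fs[OF r's]] w0 f0(2) by (simp add: infsum_nonneg)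
    qed
    then show "\<sigma> \<in> dual_cone (P0 \<inter> D0)" using assms(3) by (simp add: dual_cone_def)
  }
qed

end
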